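(* Let $(\Sigma,\tau)$ be a subshift without isolated periodic points whose complexity $\rho$ satisfies $\lim_{n\to\infty}\left(\frac{\log n}{n}\right)^2\rho(n)=0$. 1. For every symmetric and finitely supported probability measure $\mu$ on $[[\tau]]$, there exists $C_1>0$ such that for every $n\geq 1$ $$\mu^{*2n}(e)\geq\frac{1}{C_1}\exp\Big(-C_1\,\rho\big(\lceil C_1\sqrt{n\log n}\,\rceil\big)\log n\Big).$$ 2. Suppose moreover that there exist $C>0$ and $\alpha\in[1,2)$ such that $\rho(n)\leq Cn^{\alpha}$ for all $n \geq 1$. Then for any finitely generated subgroup $G$ of $[[\tau]]$, every finite symmetric generating set $S$ of $G$ and every $\varepsilon>0$, there exists $C_2>0$ such that for every $n\geq 1$ $$\operatorname{F\o l}_{G,S}(n)\leq C_2\exp\big(C_2\,n^{2\alpha/(2-\alpha)+\varepsilon}\big).$$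
   Context: Let $\mathcal{A}$ be a finite alphabet and give $\mathcal{A}^{\mathbb{Z}}$ the product topology. The shift $\tau$ acts by $(\tau x)_i=x_{i+1}$. A subshift $(\Sigma,\tau)$ is a closed shift-invariant subset $\Sigma\subset\mathcal{A}^{\mathbb{Z}}$ with the restriction of $\tau$. "Without isolated periodic points" means that no $\tau$-periodic point of $\Sigma$ is isolated in $\Sigma$. The complexity $\rho(n)$ is the number of words of length $n$ over $\mathcal{A}$ that appear as sub-words of sequences in $\Sigma$. The topological full group $[[\tau]]$ is the group of homeomorphisms $g$ of $\Sigma$ such that there is a continuous function $k_g:\Sigma\to\mathbb{Z}$ with $g(x)=\tau^{k_g(x)}(x)$ for all $x\in\Sigma$. Here $\mu^{*m}$ denotes the $m$-th convolution power of $\mu$ and $e$ the identity; $\mu$ is symmetric if $\mu(g)=\mu(g^{-1})$, and its support need not generate $[[\tau]]$. For a finitely generated amenable group $G$ with finite symmetric generating set $S$, the F\o lner function is $$\operatorname{F\o l}_{G,S}(n)=\min\Big\{|F| : F\subset G \text{ finite non-empty},\ |\partial_S F|\leq \tfrac1n|F|\Big\},\qquad \partial_S F=\{g\in F : \exists s\in S,\ sg\notin F\}.$$ *)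

theory Defs
  imports "HOL-Probability.Probability" "HOL-Algebra.Bij" "HOL-Algebra.Generated_Groups"
begin

definition full_shift_topology :: "'a set \<Rightarrow> (int \<Rightarrow> 'a) topology" where
  "full_shift_topology A = product_topology (\<lambda>_. discrete_topology A) UNIV"

definition shift :: "(int \<Rightarrow> 'a) \<Rightarrow> int \<Rightarrow> 'a" where
  "shift x = (\<lambda>i. x (i + 1))"

definition shift_pow :: "int \<Rightarrow> (int \<Rightarrow> 'a) \<Rightarrow> int \<Rightarrow> 'a" where
  "shift_pow k = (if k \<ge> 0 then shift ^^ nat k else inv_into UNIV shift ^^ nat (- k))"

lemma shift_funpow: "(shift ^^ n) x = (\<lambda>i. x (i + int n))"
  by (induction n) (auto simp: shift_def algebra_simps)

lemma inv_shift: "inv_into UNIV shift x = (\<lambda>i. x (i - 1))"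
proof -
  have "inj (shift :: (int \<Rightarrow> 'a) \<Rightarrow> _)"
  proof (rule injI, rule ext)
    fix x y :: "int \<Rightarrow> 'a" and i
    assume "shift x = shift y"
    then have "shift x (i - 1) = shift y (i - 1)" by simp
    then show "x i = y i" by (simp add: shift_def)
  qed
  then show ?thesis
    by (rule inv_f_eq) (simp add: shift_def)
qed

lemma shift_pow_eq: "shift_pow k x = (\<lambda>i. x (i + k))"
proof -
  have "(inv_into UNIV shift ^^ n) x = (\<lambda>i. x (i - int n))" for n
    by (induction n) (auto simp: inv_shift algebra_simps)
  then show ?thesis
    by (auto simp: shift_pow_def shift_funpow)
qed

text \<open>Shift-invariance is two-sided, \<open>shift ` X = X\<close>, so that the shift restricts to a
  homeomorphism of \<open>X\<close>.\<close>

definition subshift :: "'a set \<Rightarrow> (int \<Rightarrow> 'a) set \<Rightarrow> bool" where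
  "subshift A X \<longleftrightarrow> finite A \<and> closedin (full_shift_topology A) X \<and> shift ` X = X"

definition subshift_topology :: "'a set \<Rightarrow> (int \<Rightarrow> 'a) set \<Rightarrow> (int \<Rightarrow> 'a) topology" where
  "subshift_topology A X = subtopology (full_shift_topology A) X"

definition periodic_point :: "(int \<Rightarrow> 'a) \<Rightarrow> bool" where
  "periodic_point x \<longleftrightarrow> (\<exists>p\<ge>1. (shift ^^ p) x = x)"

definition no_isolated_periodic_points :: "'a set \<Rightarrow> (int \<Rightarrow> 'a) set \<Rightarrow> bool" where
  "no_isolated_periodic_points A X \<longleftrightarrow>
     (\<forall>x\<in>X. periodic_point x \<longrightarrow> \<not> openin (subshift_topology A X) {x})"

definition subshift_words :: "(int \<Rightarrow> 'a) set \<Rightarrow> nat \<Rightarrow> 'a list set" where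
  "subshift_words X n = {map (\<lambda>j. x (i + int j)) [0..<n] | x i. x \<in> X}"

definition complexity :: "(int \<Rightarrow> 'a) set \<Rightarrow> nat \<Rightarrow> nat" where
  "complexity X n = card (subshift_words X n)"

text \<open>Elements are maps on \<open>X\<close>, represented as functions that are \<open>undefined\<close> outside \<open>X\<close>;
  the multiplication \<open>g \<otimes> h\<close> inherited from \<^const>\<open>BijGroup\<close> is the composition of \<open>g\<close> after \<open>h\<close>.\<close>

definition topological_full_group ::
    "'a set \<Rightarrow> (int \<Rightarrow> 'a) set \<Rightarrow> ((int \<Rightarrow> 'a) \<Rightarrow> (int \<Rightarrow> 'a)) monoid" where
  "topological_full_group A X = BijGroup X
     \<lparr>carrier := {g \<in> Bij X. homeomorphic_map (subshift_topology A X) (subshift_topology A X) g \<and>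
        (\<exists>k. continuous_map (subshift_topology A X) (discrete_topology (UNIV :: int set)) k \<and>
             (\<forall>x\<in>X. g x = shift_pow (k x) x))}\<rparr>"

definition convolution :: "('g, 'b) monoid_scheme \<Rightarrow> 'g pmf \<Rightarrow> 'g pmf \<Rightarrow> 'g pmf" where
  "convolution G \<mu> \<nu> = map_pmf (\<lambda>(g, h). g \<otimes>\<^bsub>G\<^esub> h) (pair_pmf \<mu> \<nu>)"

primrec convolution_power :: "('g, 'b) monoid_scheme \<Rightarrow> 'g pmf \<Rightarrow> nat \<Rightarrow> 'g pmf" where
  "convolution_power G \<mu> 0 = return_pmf \<one>\<^bsub>G\<^esub>"
| "convolution_power G \<mu> (Suc n) = convolution G (convolution_power G \<mu> n) \<mu>"

definition symmetric_pmf :: "('g, 'b) monoid_scheme \<Rightarrow> 'g pmf \<Rightarrow> bool" where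
  "symmetric_pmf G \<mu> \<longleftrightarrow> (\<forall>g\<in>carrier G. pmf \<mu> g = pmf \<mu> (inv\<^bsub>G\<^esub> g))"

definition inner_boundary :: "('g, 'b) monoid_scheme \<Rightarrow> 'g set \<Rightarrow> 'g set \<Rightarrow> 'g set" where
  "inner_boundary G S F = {g \<in> F. \<exists>s\<in>S. s \<otimes>\<^bsub>G\<^esub> g \<notin> F}"

text \<open>The infimum is taken in \<^typ>\<open>enat\<close>: it is a minimum whenever some \<open>F\<close> is admissible, and
  \<open>\<infinity>\<close> otherwise. Finiteness for every \<open>n \<ge> 1\<close> is Foelner's criterion, so a finite upper bound
  for all \<open>n\<close> includes the amenability of \<open>G\<close>.\<close>

definition foelner_function :: "('g, 'b) monoid_scheme \<Rightarrow> 'g set \<Rightarrow> nat \<Rightarrow> enat" where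
  "foelner_function G S n =
     (INF F \<in> {F. F \<subseteq> carrier G \<and> finite F \<and> F \<noteq> {} \<and>
                  real (card (inner_boundary G S F)) \<le> 1 / real n * real (card F)}. enat (card F))"

definition symmetric_generating_set :: "('g, 'b) monoid_scheme \<Rightarrow> 'g set \<Rightarrow> bool" where
  "symmetric_generating_set G S \<longleftrightarrow>
     S \<subseteq> carrier G \<and> (\<forall>s\<in>S. inv\<^bsub>G\<^esub> s \<in> S) \<and> generate G S = carrier G"

end

theory Submission
  imports Defs
begin

text \<open>
  Let \<open>g = s\<^sub>1 \<circ> \<dots> \<circ> s\<^sub>n\<close> be the random walk driven by \<open>\<mu>\<close>. On the orbit of a point \<open>x\<close> every
  element of the full group acts by moving \<open>x\<close> along the integers, and the successive images of \<open>x\<close>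
  under the walk perform a walk on \<open>\<int>\<close> with bounded jumps. The steps depend on \<open>x\<close> only through a
  bounded window around the current position, and the transition kernel is symmetric: the
  displacement of \<open>s\<inverse>\<close> at \<open>s(x)\<close> is the negative of the displacement of \<open>s\<close> at \<open>x\<close>, because without
  isolated periodic points the displacement function of a full group element is unique
  (\<open>cocycle_unique\<close>, \<open>cocycle_inverse\<close>). A symmetric kernel of bounded range satisfies the
  Varopoulos-Carne Gaussian bound, here with a harmless polynomial factor (\<open>carne_bound\<close>).

  Hence the walk of a single point stays within \<open>R = O(\<surd>(n log n))\<close> up to time \<open>n\<close> with a probability
  of failure smaller than any prescribed power of \<open>1/n\<close>. The trajectories see only a window of length
  \<open>O(n)\<close>, of which there are at most \<open>O(n\<^sup>2)\<close> by the hypothesis on the complexity, so with probability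
  at least one half all points stay within \<open>R\<close> simultaneously (\<open>confinement_probability\<close>). In that
  event \<open>g\<close> is given by a function from the words of length \<open>2(R + K) + 1\<close> to \<open>{-R..R}\<close>, so it
  lies in a set of at most \<open>(2R + 1) ^ \<rho>(2(R + K) + 1)\<close> elements (\<open>product_in_confined\<close>). Since
  \<open>\<mu>\<^sup>*\<^sup>2\<^sup>n(e)\<close> is the sum of the squares of the values of \<open>\<mu>\<^sup>*\<^sup>n\<close>, the Cauchy-Schwarz inequality on
  this set gives the lower bound (\<open>return_probability_confined\<close>, \<open>return_probability_lower_bound\<close>).

  For the Foelner function let \<open>\<mu>\<close> be uniform on \<open>S \<union> {e}\<close>. For polynomial complexity the bound
  reads \<open>\<mu>\<^sup>*\<^sup>2\<^sup>n(e) \<ge> exp(-D n powr \<gamma>)\<close> for any \<open>\<gamma> > \<alpha>/2\<close>. Then for some \<open>m < M\<close> the return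
  probability drops by a relative amount of at most \<open>D M powr (\<gamma> - 1)\<close> in one step, which says that
  \<open>f = \<mu>\<^sup>*\<^sup>m\<close> has small Dirichlet energy (\<open>dirichlet_form_le\<close>). Cheeger's argument, applied to \<open>f\<close> cut
  off at height \<open>\<mu>\<^sup>*\<^sup>2\<^sup>m(e)/4\<close>, produces a level set of cardinality at most \<open>4/\<mu>\<^sup>*\<^sup>2\<^sup>m(e)\<close> with boundary
  ratio of order \<open>M powr ((\<gamma> - 1)/2)\<close> (\<open>foelner_set_of_slow_decay\<close>). Taking \<open>M\<close> of order
  \<open>n powr (2/(1 - \<gamma>))\<close> makes this ratio \<open>1/n\<close> and the cardinality \<open>exp(O(n powr (2\<gamma>/(1 - \<gamma>))))\<close>;
  at \<open>\<gamma> = \<alpha>/2\<close> the exponent would be \<open>2\<alpha>/(2 - \<alpha>)\<close>, and the room in \<open>\<epsilon>\<close> pays for the logarithms.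
\<close>

section \<open>Off-diagonal decay for symmetric kernels of bounded range\<close>

definition kernel_op :: "'b set \<Rightarrow> ('b \<Rightarrow> 'b \<Rightarrow> real) \<Rightarrow> ('b \<Rightarrow> real) \<Rightarrow> 'b \<Rightarrow> real" where
  "kernel_op B P f i = (\<Sum>j\<in>B. P i j * f j)"

text \<open>The operators \<open>T\<^sub>k(P)\<close> for the Chebyshev polynomials \<open>T\<^sub>k\<close> of the first kind.\<close>

fun chebyshev_op :: "'b set \<Rightarrow> ('b \<Rightarrow> 'b \<Rightarrow> real) \<Rightarrow> nat \<Rightarrow> ('b \<Rightarrow> real) \<Rightarrow> 'b \<Rightarrow> real" where
  "chebyshev_op B P 0 f = f"
| "chebyshev_op B P (Suc 0) f = kernel_op B P f"
| "chebyshev_op B P (Suc (Suc k)) f =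
     (\<lambda>i. 2 * kernel_op B P (chebyshev_op B P (Suc k) f) i - chebyshev_op B P k f i)"

locale symmetric_kernel =
  fixes B :: "'b set" and P :: "'b \<Rightarrow> 'b \<Rightarrow> real"
  assumes finite_B: "finite B"
    and P_nonneg: "0 \<le> P i j"
    and P_sym: "P i j = P j i"
    and row_sum_le: "(\<Sum>j\<in>B. P i j) \<le> 1"
begin

abbreviation "L \<equiv> kernel_op B P"
abbreviation "T \<equiv> chebyshev_op B P"
abbreviation "ip f g \<equiv> (\<Sum>i\<in>B. f i * (g i :: real))"

lemma kernel_op_linear:
  "L (\<lambda>i. a * f i + b * g i) = (\<lambda>i. a * L f i + b * L g i)"
  unfolding kernel_op_def
  by (rule ext) (simp add: sum_distrib_left sum.distrib algebra_simps)

lemma kernel_op_power_linear: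
  "(L ^^ n) (\<lambda>i. a * f i + b * g i) = (\<lambda>i. a * (L ^^ n) f i + b * (L ^^ n) g i)"
  by (induction n) (simp_all add: kernel_op_linear)

lemma kernel_op_self_adjoint: "ip (L f) g = ip f (L g)"
proof -
  have "ip (L f) g = (\<Sum>i\<in>B. \<Sum>j\<in>B. P i j * f j * g i)"
    unfolding kernel_op_def by (simp add: sum_distrib_right)
  also have "\<dots> = (\<Sum>j\<in>B. \<Sum>i\<in>B. P i j * f j * g i)" by (rule sum.swap)
  also have "\<dots> = ip f (L g)"
    unfolding kernel_op_def
    by (intro sum.cong refl) (simp add: sum_distrib_left P_sym mult_ac)
  finally show ?thesis .
qed

text \<open>The Schur test: the row sums bound one Cauchy-Schwarz factor, and by symmetry the column sums
  bound what remains.\<close>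

lemma kernel_op_contraction: "ip (L f) (L f) \<le> ip f f"
proof -
  have *: "L f i * L f i \<le> (\<Sum>j\<in>B. P i j * (f j * f j))" for i
  proof -
    have "(L f i)\<^sup>2 = (\<Sum>j\<in>B. sqrt (P i j) * (sqrt (P i j) * f j))\<^sup>2"
      unfolding kernel_op_def using P_nonneg by (simp add: mult.assoc[symmetric])
    also have "\<dots> \<le> (\<Sum>j\<in>B. (sqrt (P i j))\<^sup>2) * (\<Sum>j\<in>B. (sqrt (P i j) * f j)\<^sup>2)"
      by (rule Cauchy_Schwarz_ineq_sum)
    also have "\<dots> = (\<Sum>j\<in>B. P i j) * (\<Sum>j\<in>B. P i j * (f j * f j))"
      using P_nonneg by (simp add: power_mult_distrib power2_eq_square[of "f _"])
    also have "\<dots> \<le> 1 * (\<Sum>j\<in>B. P i j * (f j * f j))"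
      by (intro mult_right_mono row_sum_le sum_nonneg) (simp add: P_nonneg)
    finally show ?thesis by (simp add: power2_eq_square)
  qed
  have "ip (L f) (L f) \<le> (\<Sum>i\<in>B. \<Sum>j\<in>B. P i j * (f j * f j))"
    by (intro sum_mono *)
  also have "\<dots> = (\<Sum>j\<in>B. (\<Sum>i\<in>B. P j i) * (f j * f j))"
    by (subst sum.swap) (simp add: sum_distrib_right P_sym)
  also have "\<dots> \<le> (\<Sum>j\<in>B. 1 * (f j * f j))"
    by (intro sum_mono mult_right_mono row_sum_le) auto
  finally show ?thesis by simp
qed

text \<open>The recursion \<open>u\<^sub>k\<^sub>+\<^sub>2 + u\<^sub>k = 2 P u\<^sub>k\<^sub>+\<^sub>1\<close> of \<open>u\<^sub>k = T\<^sub>k(P) f\<close> is a discrete wave equation; this is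
  its conserved energy. Pairing \<open>u\<^sub>k\<^sub>+\<^sub>2 + u\<^sub>k - 2 P u\<^sub>k\<^sub>+\<^sub>1 = 0\<close> with \<open>u\<^sub>k\<^sub>+\<^sub>2 - u\<^sub>k\<close> gives the
  conservation law.\<close>

lemma chebyshev_energy:
  "ip (T (Suc k) f) (T (Suc k) f) + ip (T k f) (T k f) - 2 * ip (L (T k f)) (T (Suc k) f)
     = ip f f - ip (L f) (L f)"
proof (induction k)
  case 0 show ?case by simp
next
  case (Suc k)
  let ?a = "T k f" and ?b = "T (Suc k) f" and ?c = "T (Suc (Suc k)) f"
  have 1: "ip ?c ?c = 4 * ip (L ?b) (L ?b) - 4 * ip (L ?b) ?a + ip ?a ?a"
    by (simp add: algebra_simps sum.distrib sum_subtractf sum_distrib_left)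
  have 2: "ip (L ?b) ?c = 2 * ip (L ?b) (L ?b) - ip (L ?b) ?a"
    by (simp add: algebra_simps sum.distrib sum_subtractf sum_distrib_left)
  have 3: "ip (L ?a) ?b = ip (L ?b) ?a"
    by (metis (no_types, lifting) kernel_op_self_adjoint mult.commute sum.cong)
  show ?case using Suc 1 2 3 by (simp del: chebyshev_op.simps)
qed

text \<open>Completing the square, the energy is \<open>|u\<^sub>k\<^sub>+\<^sub>1 - P u\<^sub>k|\<^sup>2 + |u\<^sub>k|\<^sup>2 - |P u\<^sub>k|\<^sup>2\<close>, so
  \<open>u\<^sub>k\<^sub>+\<^sub>1\<close> is within \<open>|f|\<close> of \<open>P u\<^sub>k\<close> and the norms grow at most linearly. The spectral theorem would
  give the bound \<open>|f|\<close>; the linear bound costs a polynomial factor later on and avoids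
  spectral theory.\<close>

lemma chebyshev_norm: "L2_set (T k f) B \<le> real (k + 1) * L2_set f B"
proof (induction k)
  case 0 show ?case by simp
next
  case (Suc k)
  let ?a = "T k f" and ?b = "T (Suc k) f"
  have ip2: "L2_set g B = sqrt (ip g g)" for g
    by (simp add: L2_set_def power2_eq_square)
  have "ip (\<lambda>i. ?b i - L ?a i) (\<lambda>i. ?b i - L ?a i)
      = ip ?b ?b + ip (L ?a) (L ?a) - 2 * ip (L ?a) ?b"
    by (simp add: algebra_simps sum.distrib sum_subtractf sum_distrib_left)
  also have "\<dots> \<le> ip f f"
    using chebyshev_energy[of k f] kernel_op_contraction[of ?a]
      sum_nonneg[of B "\<lambda>i. L f i * L f i"] by fastforce
  finally have 1: "L2_set (\<lambda>i. ?b i - L ?a i) B \<le> L2_set f B"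
    by (simp add: ip2)
  have 2: "L2_set (L ?a) B \<le> L2_set ?a B"
    by (simp add: ip2 kernel_op_contraction)
  have "L2_set ?b B = L2_set (\<lambda>i. (?b i - L ?a i) + L ?a i) B" by simp
  also have "\<dots> \<le> L2_set (\<lambda>i. ?b i - L ?a i) B + L2_set (L ?a) B"
    by (rule L2_set_triangle_ineq)
  also have "\<dots> \<le> real (Suc k + 1) * L2_set f B"
    using 1 2 Suc by (simp add: algebra_simps)
  finally show ?case .
qed

lemma chebyshev_pointwise:
  assumes "a \<in> B" "j \<in> B"
  shows "\<bar>T k (\<lambda>i. if i = a then 1 else 0) j\<bar> \<le> real (k + 1)"
proof -
  let ?d = "\<lambda>i. if i = a then 1 else 0 :: real"
  have "L2_set ?d B = 1"
  proof -
    have "(\<Sum>i\<in>B. (?d i)\<^sup>2) = (\<Sum>i\<in>B. ?d i)" by (rule sum.cong) auto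
    also have "\<dots> = 1" using assms finite_B by simp
    finally show ?thesis by (simp add: L2_set_def)
  qed
  then have "L2_set (T k ?d) B \<le> real (k + 1)"
    using chebyshev_norm[of k ?d] by simp
  moreover have "\<bar>T k ?d j\<bar> \<le> L2_set (T k ?d) B"
  proof -
    have "\<bar>T k ?d j\<bar> = L2_set (T k ?d) {j}" by simp
    also have "\<dots> \<le> L2_set (T k ?d) B"
      unfolding L2_set_def using assms finite_B
      by (intro real_sqrt_le_mono sum_mono2) auto
    finally show ?thesis .
  qed
  ultimately show ?thesis by linarith
qed

text \<open>With the indices extended evenly to \<open>\<int>\<close>, multiplication by \<open>P\<close> becomes one step of the simple
  random walk on the index, including at \<open>k = 0\<close>.\<close>

lemma chebyshev_step:
  fixes k :: int
  shows "L (T (nat \<bar>k\<bar>) f) =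
    (\<lambda>i. 1/2 * T (nat \<bar>k - 1\<bar>) f i + 1/2 * T (nat \<bar>k + 1\<bar>) f i)"
proof -
  have *: "L (T m f) = (\<lambda>i. 1/2 * T (nat \<bar>int m - 1\<bar>) f i + 1/2 * T (nat \<bar>int m + 1\<bar>) f i)" for m
  proof (cases m)
    case 0 then show ?thesis by auto
  next
    case (Suc l)
    have "nat \<bar>int m - 1\<bar> = l" "nat \<bar>int m + 1\<bar> = Suc (Suc l)" using Suc by auto
    then show ?thesis using Suc by (simp add: fun_eq_iff field_simps)
  qed
  show ?thesis
  proof (cases "k \<ge> 0")
    case True
    then show ?thesis using *[of "nat \<bar>k\<bar>"] by simp
  next
    case False
    define m where "m = nat (- k)"
    have k: "k = - int m" using False by (simp add: m_def)
    then have "nat \<bar>k\<bar> = m" "\<bar>k - 1\<bar> = \<bar>int m + 1\<bar>" "\<bar>k + 1\<bar> = \<bar>int m - 1\<bar>" by auto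
    then show ?thesis using *[of m] by (simp only: add.commute)
  qed
qed

lemma kernel_power_chebyshev:
  fixes k :: int
  shows "(L ^^ Suc n) (T (nat \<bar>k\<bar>) f) i =
    1/2 * (L ^^ n) (T (nat \<bar>k - 1\<bar>) f) i + 1/2 * (L ^^ n) (T (nat \<bar>k + 1\<bar>) f) i"
  by (simp only: funpow_Suc_right o_apply chebyshev_step kernel_op_power_linear)

end

lemma cosh_add_cosh_diff:
  fixes t :: real
  shows "cosh (t * (k - 1)) + cosh (t * (k + 1)) = 2 * cosh (t * k) * cosh t"
  by (simp add: cosh_def algebra_simps exp_add exp_diff exp_minus field_simps)

text \<open>Both sides agree at zero, and the derivative of \<open>ln cosh\<close> is \<open>tanh t \<le> t\<close>.\<close>

lemma cosh_le_exp_square: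
  fixes t :: real
  shows "cosh t \<le> exp (t\<^sup>2 / 2)"
proof -
  have tanh_le: "tanh s \<le> s" if "s \<ge> 0" for s :: real
  proof -
    have "0 - tanh 0 \<le> s - tanh s"
      by (rule DERIV_nonneg_imp_nondecreasing[OF that])
        (auto intro!: exI derivative_eq_intros)
    then show ?thesis by simp
  qed
  have pos: "cosh s \<le> exp (s\<^sup>2 / 2)" if "s \<ge> 0" for s :: real
  proof -
    have "0\<^sup>2 / 2 - ln (cosh 0) \<le> s\<^sup>2 / 2 - ln (cosh s)"
    proof (rule DERIV_nonneg_imp_nondecreasing[OF that])
      fix x :: real assume "0 \<le> x" "x \<le> s"
      have "((\<lambda>x. x\<^sup>2 / 2 - ln (cosh x)) has_real_derivative x - tanh x) (at x)"
        by (auto intro!: derivative_eq_intros simp: tanh_def)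
      then show "\<exists>y. ((\<lambda>x. x\<^sup>2 / 2 - ln (cosh x)) has_real_derivative y) (at x) \<and> 0 \<le> y"
        using tanh_le[OF \<open>0 \<le> x\<close>] by (intro exI[of _ "x - tanh x"]) auto
    qed
    then have "ln (cosh s) \<le> s\<^sup>2 / 2" by simp
    then show ?thesis by (metis cosh_real_pos exp_le_cancel_iff exp_ln)
  qed
  show ?thesis using pos[of t] pos[of "- t"] by (cases "t \<ge> 0") auto
qed

locale symmetric_range_kernel = symmetric_kernel B P for B :: "int set" and P +
  fixes K :: nat
  assumes range_bound: "P i j \<noteq> 0 \<Longrightarrow> \<bar>i - j\<bar> \<le> int K"
    and origin: "0 \<in> B"
begin

abbreviation "\<delta> \<equiv> \<lambda>i :: int. if i = 0 then 1 else 0 :: real"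

text \<open>Finite propagation speed: \<open>T\<^sub>k\<close> has degree \<open>k\<close>, and one application of the kernel moves mass by
  at most \<open>K\<close>.\<close>

lemma chebyshev_support: "T k \<delta> j \<noteq> 0 \<Longrightarrow> \<bar>j\<bar> \<le> int k * int K"
proof (induction k arbitrary: j rule: less_induct)
  case (less k)
  have L: "\<bar>j\<bar> \<le> (int m + 1) * int K"
    if "L (T m \<delta>) j \<noteq> 0" "m < k" for m j
  proof -
    from that obtain i where i: "P j i \<noteq> 0" "T m \<delta> i \<noteq> 0"
      unfolding kernel_op_def by (metis (no_types, lifting) mult_eq_0_iff sum.neutral)
    from less.IH[OF that(2) i(2)] range_bound[OF i(1)]
    show ?thesis by (simp add: algebra_simps)
  qed
  consider "k = 0" | "k = Suc 0" | m where "k = Suc (Suc m)"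
    by (metis not0_implies_Suc)
  then show ?case
  proof cases
    case 1
    then show ?thesis using less.prems by (auto split: if_splits)
  next
    case 2
    then show ?thesis using less.prems L[of 0 j] by auto
  next
    case k: (3 m)
    show ?thesis
    proof (cases "T m \<delta> j = 0")
      case True
      then show ?thesis using less.prems L[of "Suc m" j] k by (auto simp: algebra_simps)
    next
      case False
      then have "\<bar>j\<bar> \<le> int m * int K" using less.IH k by auto
      also have "\<dots> \<le> int k * int K" using k by (intro mult_right_mono) auto
      finally show ?thesis .
    qed
  qed
qed

text \<open>By \<open>kernel_power_chebyshev\<close>, \<open>P\<^sup>n T\<^sub>k\<close> is an average over a simple random walk started at \<open>k\<close>,
  and \<open>cosh (t k) * cosh t ^ n\<close> is what this walk makes of the function \<open>cosh (t k)\<close>. It remains to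
  check \<open>n = 0\<close>, where finite propagation speed forces \<open>|j| \<le> |k| K\<close> on the support, so that the
  factor \<open>2 cosh (t k) exp (-t |j| / K)\<close> is at least one.\<close>

lemma chebyshev_power_bound:
  fixes k :: int and t :: real
  assumes j: "j \<in> B" and K: "K > 0" and t: "t \<ge> 0" and "nat \<bar>k\<bar> + n \<le> N"
  shows "\<bar>(L ^^ n) (T (nat \<bar>k\<bar>) \<delta>) j\<bar>
    \<le> real (N + 1) * (2 * cosh (t * k) * cosh t ^ n * exp (- t * \<bar>j\<bar> / K))"
  using assms(4)
proof (induction n arbitrary: k)
  case 0
  show ?case
  proof (cases "T (nat \<bar>k\<bar>) \<delta> j = 0")
    case True
    then show ?thesis by (auto simp: cosh_def)
  next
    case False
    then have "\<bar>j\<bar> \<le> int (nat \<bar>k\<bar>) * int K" by (rule chebyshev_support)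
    then have "\<bar>j\<bar> \<le> \<bar>k\<bar> * int K" by simp
    then have "real_of_int \<bar>j\<bar> \<le> real_of_int \<bar>k\<bar> * real K" by (metis of_int_le_iff of_int_mult of_int_of_nat_eq)
    then have *: "real_of_int \<bar>j\<bar> / K \<le> real_of_int \<bar>k\<bar>" using K by (simp add: field_simps)
    have "t * \<bar>j\<bar> / K \<le> t * real_of_int \<bar>k\<bar>"
      using mult_left_mono[OF * t] by simp
    then have "exp (t * \<bar>j\<bar> / K) \<le> exp (t * real_of_int \<bar>k\<bar>)" by simp
    also have "\<dots> \<le> 2 * cosh (t * k)"
      by (simp add: cosh_def abs_if)
    finally have "1 \<le> 2 * cosh (t * k) * exp (- t * \<bar>j\<bar> / K)"
      by (simp add: exp_minus field_simps)
    moreover have "\<bar>T (nat \<bar>k\<bar>) \<delta> j\<bar> \<le> real (N + 1)"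
      using chebyshev_pointwise[OF origin j, of "nat \<bar>k\<bar>"] 0 by linarith
    ultimately show ?thesis
      using mult_mono[of "\<bar>T (nat \<bar>k\<bar>) \<delta> j\<bar>" "real (N+1)" 1] by simp
  qed
next
  case (Suc n)
  let ?E = "real (N + 1) * cosh t ^ n * exp (- t * \<bar>j\<bar> / K)"
  have "\<bar>(L ^^ Suc n) (T (nat \<bar>k\<bar>) \<delta>) j\<bar>
      \<le> 1/2 * \<bar>(L ^^ n) (T (nat \<bar>k - 1\<bar>) \<delta>) j\<bar> + 1/2 * \<bar>(L ^^ n) (T (nat \<bar>k + 1\<bar>) \<delta>) j\<bar>"
    unfolding kernel_power_chebyshev by linarith
  also have "\<dots> \<le> ?E * (cosh (t * (real_of_int k - 1)) + cosh (t * (real_of_int k + 1)))"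
  proof -
    have "nat \<bar>k - 1\<bar> + n \<le> N" "nat \<bar>k + 1\<bar> + n \<le> N" using Suc.prems by auto
    from this[THEN Suc.IH]
    have "\<bar>(L ^^ n) (T (nat \<bar>k - 1\<bar>) \<delta>) j\<bar> \<le> ?E * (2 * cosh (t * (real_of_int k - 1)))"
      "\<bar>(L ^^ n) (T (nat \<bar>k + 1\<bar>) \<delta>) j\<bar> \<le> ?E * (2 * cosh (t * (real_of_int k + 1)))"
      by (simp_all only: of_int_diff of_int_add of_int_1 mult_ac)
    then show ?thesis unfolding distrib_left by linarith
  qed
  also have "\<dots> = real (N + 1) * (2 * cosh (t * k) * cosh t ^ Suc n * exp (- t * \<bar>j\<bar> / K))"
    unfolding cosh_add_cosh_diff by (simp add: algebra_simps)
  finally show ?case .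
qed

text \<open>A form of the Varopoulos-Carne inequality; the choice \<open>t = |j| / (n K)\<close> turns the exponent into
  \<open>- j\<^sup>2 / (2 n K\<^sup>2)\<close>. The parameter \<open>t\<close> is kept free so that one value serves all times up to a
  given one.\<close>

theorem carne_bound:
  assumes j: "j \<in> B" and K: "K > 0" and t: "t \<ge> 0"
  shows "\<bar>(L ^^ n) \<delta> j\<bar> \<le> 2 * real (n + 1) * exp (n * t\<^sup>2 / 2 - t * \<bar>j\<bar> / K)"
proof -
  have "\<bar>(L ^^ n) \<delta> j\<bar> \<le> real (n + 1) * (2 * cosh t ^ n * exp (- t * \<bar>j\<bar> / K))"
    using chebyshev_power_bound[OF j K t, of 0 n n] by simp
  also have "\<dots> \<le> real (n + 1) * (2 * exp (t\<^sup>2 / 2) ^ n * exp (- t * \<bar>j\<bar> / K))"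
    by (intro mult_left_mono mult_right_mono power_mono cosh_le_exp_square) auto
  also have "\<dots> = 2 * real (n + 1) * exp (n * t\<^sup>2 / 2 - t * \<bar>j\<bar> / K)"
  proof -
    have "exp (n * t\<^sup>2 / 2 - t * \<bar>j\<bar> / K) = exp (t\<^sup>2 / 2) ^ n * exp (- t * \<bar>j\<bar> / K)"
      by (simp add: exp_of_nat_mult[symmetric] exp_add[symmetric])
    then show ?thesis by simp
  qed
  finally show ?thesis by simp
qed

end

section \<open>Convolution powers and return probabilities\<close>

context group
begin

lemma convolution_bind:
  "convolution G \<mu> \<nu> = bind_pmf \<mu> (\<lambda>s. map_pmf (\<lambda>h. s \<otimes> h) \<nu>)"
  by (simp add: convolution_def pair_pmf_def map_pmf_def bind_assoc_pmf bind_return_pmf)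

lemma set_convolution:
  "set_pmf (convolution G \<mu> \<nu>) = (\<lambda>(g, h). g \<otimes> h) ` (set_pmf \<mu> \<times> set_pmf \<nu>)"
  by (simp add: convolution_def)

lemma pmf_convolution:
  assumes "finite (set_pmf \<mu>)" "set_pmf \<mu> \<subseteq> carrier G" "set_pmf \<nu> \<subseteq> carrier G" "g \<in> carrier G"
  shows "pmf (convolution G \<mu> \<nu>) g = (\<Sum>s\<in>set_pmf \<mu>. pmf \<mu> s * pmf \<nu> (inv s \<otimes> g))"
proof -
  have *: "pmf (map_pmf (\<lambda>h. s \<otimes> h) \<nu>) g = pmf \<nu> (inv s \<otimes> g)" if "s \<in> set_pmf \<mu>" for s
  proof -
    have "s \<in> carrier G" using that assms by auto
    then have "s \<otimes> h = g \<longleftrightarrow> h = inv s \<otimes> g" if "h \<in> set_pmf \<nu>" for h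
      using that assms(3,4) inv_solve_left[of h s g] by (metis subsetD)
    then have eq: "((\<lambda>h. s \<otimes> h) -` {g}) \<inter> set_pmf \<nu> = {inv s \<otimes> g} \<inter> set_pmf \<nu>"
      by blast
    have "pmf (map_pmf (\<lambda>h. s \<otimes> h) \<nu>) g = measure \<nu> ((\<lambda>h. s \<otimes> h) -` {g} \<inter> set_pmf \<nu>)"
      by (simp add: pmf_map measure_Int_set_pmf)
    also have "\<dots> = pmf \<nu> (inv s \<otimes> g)"
      unfolding eq by (simp add: measure_Int_set_pmf pmf.rep_eq)
    finally show ?thesis .
  qed
  have "pmf (convolution G \<mu> \<nu>) g = (\<Sum>s\<in>set_pmf \<mu>. pmf (map_pmf (\<lambda>h. s \<otimes> h) \<nu>) g * pmf \<mu> s)"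
    unfolding convolution_bind pmf_bind
    by (rule integral_measure_pmf_real) (use assms in auto)
  also have "\<dots> = (\<Sum>s\<in>set_pmf \<mu>. pmf \<mu> s * pmf \<nu> (inv s \<otimes> g))"
    by (intro sum.cong refl) (simp add: * mult.commute)
  finally show ?thesis .
qed

lemma convolution_assoc:
  assumes "set_pmf \<mu> \<subseteq> carrier G" "set_pmf \<nu> \<subseteq> carrier G" "set_pmf \<rho> \<subseteq> carrier G"
  shows "convolution G (convolution G \<mu> \<nu>) \<rho> = convolution G \<mu> (convolution G \<nu> \<rho>)"
  unfolding convolution_bind map_bind_pmf bind_assoc_pmf bind_map_pmf pmf.map_comp
  by (intro bind_pmf_cong refl map_pmf_cong) (use assms in \<open>auto simp: subset_iff m_assoc\<close>)

lemma set_convolution_power: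
  assumes "subgroup H G" "set_pmf \<mu> \<subseteq> H"
  shows "set_pmf (convolution_power G \<mu> n) \<subseteq> H"
proof (induction n)
  case 0 show ?case using assms by (simp add: subgroup.one_closed)
next
  case (Suc n)
  then show ?case using assms
    by (auto simp: set_convolution intro!: subgroup.m_closed)
qed

lemma convolution_power_carrier:
  assumes "set_pmf \<mu> \<subseteq> carrier G"
  shows "set_pmf (convolution_power G \<mu> n) \<subseteq> carrier G"
  by (rule set_convolution_power[OF subgroup_self assms])

lemma finite_convolution_power:
  assumes "finite (set_pmf \<mu>)"
  shows "finite (set_pmf (convolution_power G \<mu> n))"
  using assms by (induction n) (auto simp: set_convolution)

lemma convolution_one:
  assumes "set_pmf \<mu> \<subseteq> carrier G"
  shows "convolution G (return_pmf \<one>) \<mu> = \<mu>" "convolution G \<mu> (return_pmf \<one>) = \<mu>"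
proof -
  have id: "map_pmf f \<mu> = \<mu>" if "\<And>h. h \<in> carrier G \<Longrightarrow> f h = h" for f
    using map_pmf_cong[of \<mu> \<mu> f "\<lambda>h. h"] that assms by (auto simp: subset_iff)
  then show "convolution G (return_pmf \<one>) \<mu> = \<mu>" "convolution G \<mu> (return_pmf \<one>) = \<mu>"
    by (simp_all add: convolution_bind bind_return_pmf id flip: map_pmf_def)
qed

lemma convolution_power_add:
  assumes "set_pmf \<mu> \<subseteq> carrier G"
  shows "convolution_power G \<mu> (m + n) =
    convolution G (convolution_power G \<mu> m) (convolution_power G \<mu> n)"
proof (induction n)
  case 0 then show ?case by (simp add: convolution_one(2) convolution_power_carrier[OF assms])
next
  case (Suc n) then show ?case
    by (simp add: convolution_assoc convolution_power_carrier[OF assms] assms)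
qed

lemma convolution_power_Suc_left:
  assumes "set_pmf \<mu> \<subseteq> carrier G"
  shows "convolution_power G \<mu> (Suc n) = convolution G \<mu> (convolution_power G \<mu> n)"
  using convolution_power_add[OF assms, of 1 n] assms by (simp add: convolution_one)

text \<open>The walk as a product of independent letters. Read as a composition of maps, the last letter of
  the list acts first, so the suffixes of the list are the intermediate times of the walk of a point.\<close>

lemma convolution_power_replicate:
  assumes "set_pmf \<mu> \<subseteq> carrier G"
  shows "convolution_power G \<mu> n = map_pmf (\<lambda>w. foldr (\<otimes>) w \<one>) (replicate_pmf n \<mu>)"
proof (induction n)
  case 0 show ?case by simp
next
  case (Suc n)
  show ?case
    unfolding convolution_power_Suc_left[OF assms] Suc convolution_bind
    by (simp add: map_pmf_def bind_assoc_pmf bind_return_pmf)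
qed

lemma symmetric_pmf_map_inv:
  assumes "set_pmf \<mu> \<subseteq> carrier G"
  shows "symmetric_pmf G \<mu> \<longleftrightarrow> map_pmf (\<lambda>g. inv g) \<mu> = \<mu>"
proof -
  have *: "pmf (map_pmf (\<lambda>g. inv g) \<mu>) (inv g) = pmf \<mu> g" if "g \<in> carrier G" for g
  proof -
    have eq: "((\<lambda>g. inv g) -` {inv g}) \<inter> set_pmf \<mu> = {g} \<inter> set_pmf \<mu>"
      using assms that by (auto simp: subset_iff dest: inj_onD[OF inv_inj])
    show ?thesis
      unfolding pmf_map pmf.rep_eq[of \<mu>] by (metis eq measure_Int_set_pmf)
  qed
  have out: "pmf (map_pmf (\<lambda>g. inv g) \<mu>) g = 0" "pmf \<mu> g = 0" if "g \<notin> carrier G" for g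
    using assms that by (auto simp: pmf_eq_0_set_pmf)
  show ?thesis
  proof
    assume sym: "symmetric_pmf G \<mu>"
    show "map_pmf (\<lambda>g. inv g) \<mu> = \<mu>"
    proof (rule pmf_eqI)
      fix g show "pmf (map_pmf (\<lambda>g. inv g) \<mu>) g = pmf \<mu> g"
      proof (cases "g \<in> carrier G")
        case True
        then show ?thesis using *[of "inv g"] sym unfolding symmetric_pmf_def by (metis inv_closed inv_inv)
      qed (simp add: out)
    qed
  next
    assume "map_pmf (\<lambda>g. inv g) \<mu> = \<mu>"
    then show "symmetric_pmf G \<mu>" using * unfolding symmetric_pmf_def by metis
  qed
qed

lemma map_inv_convolution:
  assumes "set_pmf \<mu> \<subseteq> carrier G" "set_pmf \<nu> \<subseteq> carrier G"
  shows "map_pmf (\<lambda>g. inv g) (convolution G \<mu> \<nu>)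
    = convolution G (map_pmf (\<lambda>g. inv g) \<nu>) (map_pmf (\<lambda>g. inv g) \<mu>)"
proof -
  have "map_pmf (\<lambda>g. inv g) (convolution G \<mu> \<nu>)
      = bind_pmf \<mu> (\<lambda>s. bind_pmf \<nu> (\<lambda>h. return_pmf (inv (s \<otimes> h))))"
    by (simp add: convolution_bind map_pmf_def bind_assoc_pmf bind_return_pmf)
  also have "\<dots> = bind_pmf \<mu> (\<lambda>s. bind_pmf \<nu> (\<lambda>h. return_pmf (inv h \<otimes> inv s)))"
    by (intro bind_pmf_cong refl) (use assms in \<open>auto simp: subset_iff inv_mult_group\<close>)
  also have "\<dots> = bind_pmf \<nu> (\<lambda>h. bind_pmf \<mu> (\<lambda>s. return_pmf (inv h \<otimes> inv s)))"
    by (rule bind_commute_pmf)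
  finally show ?thesis
    by (simp add: convolution_bind map_pmf_def bind_assoc_pmf bind_return_pmf)
qed

lemma symmetric_convolution_power:
  assumes "set_pmf \<mu> \<subseteq> carrier G" "symmetric_pmf G \<mu>"
  shows "symmetric_pmf G (convolution_power G \<mu> n)"
proof -
  have "map_pmf (\<lambda>g. inv g) (convolution_power G \<mu> n) = convolution_power G \<mu> n"
  proof (induction n)
    case (Suc n)
    have "map_pmf (\<lambda>g. inv g) (convolution_power G \<mu> (Suc n))
        = convolution G (map_pmf (\<lambda>g. inv g) \<mu>) (map_pmf (\<lambda>g. inv g) (convolution_power G \<mu> n))"
      using assms by (simp add: map_inv_convolution convolution_power_carrier)
    also have "\<dots> = convolution_power G \<mu> (Suc n)"
      using assms Suc unfolding convolution_power_Suc_left[OF assms(1)]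
      by (simp add: symmetric_pmf_map_inv)
    finally show ?case .
  qed simp
  then show ?thesis
    using assms by (simp add: symmetric_pmf_map_inv convolution_power_carrier)
qed

text \<open>By symmetry, returning after \<open>2n\<close> steps means that two independent walks of length \<open>n\<close> meet.\<close>

lemma return_probability_eq_sum_squares:
  assumes "set_pmf \<mu> \<subseteq> carrier G" "finite (set_pmf \<mu>)" "symmetric_pmf G \<mu>"
  shows "pmf (convolution_power G \<mu> (2 * n)) \<one>
    = (\<Sum>g\<in>set_pmf (convolution_power G \<mu> n). (pmf (convolution_power G \<mu> n) g)\<^sup>2)"
proof -
  let ?p = "convolution_power G \<mu> n"
  have car: "set_pmf ?p \<subseteq> carrier G" by (rule convolution_power_carrier[OF assms(1)])
  have "pmf (convolution_power G \<mu> (2 * n)) \<one>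
      = (\<Sum>s\<in>set_pmf ?p. pmf ?p s * pmf ?p (inv s \<otimes> \<one>))"
    using convolution_power_add[OF assms(1), of n n]
      pmf_convolution[OF finite_convolution_power[OF assms(2)] car car one_closed]
    by (simp add: mult_2)
  also have "\<dots> = (\<Sum>s\<in>set_pmf ?p. (pmf ?p s)\<^sup>2)"
  proof (intro sum.cong refl)
    fix s assume s: "s \<in> set_pmf ?p"
    then have "pmf ?p (inv s) = pmf ?p s"
      using symmetric_convolution_power[OF assms(1,3), of n] car unfolding symmetric_pmf_def by (metis subsetD)
    then show "pmf ?p s * pmf ?p (inv s \<otimes> \<one>) = (pmf ?p s)\<^sup>2"
      using s car by (simp add: subset_iff power2_eq_square)
  qed
  finally show ?thesis .
qed

lemma return_probability_pos:
  assumes "set_pmf \<mu> \<subseteq> carrier G" "finite (set_pmf \<mu>)" "symmetric_pmf G \<mu>"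
  shows "pmf (convolution_power G \<mu> (2 * n)) \<one> > 0"
  unfolding return_probability_eq_sum_squares[OF assms]
  by (rule sum_pos) (use assms in \<open>auto simp: finite_convolution_power set_pmf_not_empty simp flip: set_pmf_iff\<close>)

text \<open>A small set that carries much of the mass of \<open>\<mu>\<^sup>*\<^sup>n\<close> forces a large sum of squares, by the
  Cauchy-Schwarz inequality.\<close>

lemma return_probability_ge:
  assumes "set_pmf \<mu> \<subseteq> carrier G" "finite (set_pmf \<mu>)" "symmetric_pmf G \<mu>"
    and "finite E"
  shows "(measure (convolution_power G \<mu> n) E)\<^sup>2
    \<le> real (card E) * pmf (convolution_power G \<mu> (2 * n)) \<one>"
proof -
  let ?p = "convolution_power G \<mu> n"
  have "(measure ?p E)\<^sup>2 = (\<Sum>g\<in>E. 1 * pmf ?p g)\<^sup>2"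
    using assms by (simp add: measure_measure_pmf_finite)
  also have "\<dots> \<le> (\<Sum>g\<in>E. 1\<^sup>2) * (\<Sum>g\<in>E. (pmf ?p g)\<^sup>2)"
    by (rule Cauchy_Schwarz_ineq_sum)
  also have "\<dots> = real (card E) * (\<Sum>g\<in>E. (pmf ?p g)\<^sup>2)" by simp
  also have "\<dots> \<le> real (card E) * (\<Sum>g\<in>set_pmf ?p. (pmf ?p g)\<^sup>2)"
  proof -
    have "(\<Sum>g\<in>E. (pmf ?p g)\<^sup>2) = (\<Sum>g\<in>E \<inter> set_pmf ?p. (pmf ?p g)\<^sup>2)"
      using assms(4) by (intro sum.mono_neutral_right) (auto simp: set_pmf_iff)
    also have "\<dots> \<le> (\<Sum>g\<in>set_pmf ?p. (pmf ?p g)\<^sup>2)"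
      using assms by (intro sum_mono2) (auto simp: finite_convolution_power)
    finally show ?thesis by (intro mult_left_mono) auto
  qed
  finally show ?thesis
    unfolding return_probability_eq_sum_squares[OF assms(1-3)] .
qed

end

section \<open>Foelner sets from slowly decaying return probabilities\<close>

text \<open>Integrate the inequality between the cardinalities of the level sets over the level \<open>t\<close>: the
  point \<open>g\<close> lies in the level set for \<open>0 \<le> t < u g\<close>, and the pair \<open>(g, s)\<close> contributes to the boundary
  for \<open>u (\<sigma> s g) \<le> t < u g\<close>.\<close>

lemma coarea_inequality:
  fixes u :: "'a \<Rightarrow> real" and c :: real and \<sigma> :: "'s \<Rightarrow> 'a \<Rightarrow> 'a"
  assumes fin: "finite \<Omega>" "finite S" and u: "\<And>g. 0 \<le> u g"
    and levels: "\<And>t. 0 \<le> t \<Longrightarrow> c * card {g\<in>\<Omega>. t < u g}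
      \<le> card {g\<in>\<Omega>. t < u g \<and> (\<exists>s\<in>S. u (\<sigma> s g) \<le> t)}"
  shows "c * (\<Sum>g\<in>\<Omega>. u g) \<le> (\<Sum>g\<in>\<Omega>. \<Sum>s\<in>S. \<bar>u g - u (\<sigma> s g)\<bar>)"
proof -
  let ?I = "\<lambda>a b :: real. indicator {a..<b} :: real \<Rightarrow> real"
  have int: "integrable lborel (?I a b)" for a b
    by (rule integrable_real_indicator) (cases "a \<le> b"; simp)+
  have val: "(\<integral>t. ?I a b t \<partial>lborel) = max 0 (b - a)" for a b
    by (cases "a \<le> b") (simp_all add: max_def)
  have le: "(\<integral>t. ?I a b t \<partial>lborel) \<le> \<bar>b - a\<bar>" for a b unfolding val by simp
  have "c * (\<Sum>g\<in>\<Omega>. ?I 0 (u g) t) \<le> (\<Sum>g\<in>\<Omega>. \<Sum>s\<in>S. ?I (u (\<sigma> s g)) (u g) t)" for t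
  proof (cases "t \<ge> 0")
    case False
    then have "(\<Sum>g\<in>\<Omega>. ?I 0 (u g) t) = 0" by (auto intro!: sum.neutral simp: indicator_def)
    moreover have "0 \<le> (\<Sum>g\<in>\<Omega>. \<Sum>s\<in>S. ?I (u (\<sigma> s g)) (u g) t)" by (intro sum_nonneg) auto
    ultimately show ?thesis by simp
  next
    case True
    have "(\<Sum>g\<in>\<Omega>. ?I 0 (u g) t) = (\<Sum>g\<in>\<Omega>. if t < u g then 1 else 0)"
      using True by (intro sum.cong) (auto simp: indicator_def)
    also have "\<dots> = card {g\<in>\<Omega>. t < u g}"
      using fin by (simp add: sum.If_cases Int_def)
    finally have "c * (\<Sum>g\<in>\<Omega>. ?I 0 (u g) t) = c * card {g\<in>\<Omega>. t < u g}" by simp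
    also have "\<dots> \<le> card {g\<in>\<Omega>. t < u g \<and> (\<exists>s\<in>S. u (\<sigma> s g) \<le> t)}" by (rule levels[OF True])
    also have "\<dots> = (\<Sum>g\<in>\<Omega>. if t < u g \<and> (\<exists>s\<in>S. u (\<sigma> s g) \<le> t) then 1 else 0)"
      using fin by (simp add: sum.If_cases Int_def)
    also have "\<dots> \<le> (\<Sum>g\<in>\<Omega>. \<Sum>s\<in>S. ?I (u (\<sigma> s g)) (u g) t)"
    proof (rule sum_mono)
      fix g assume "g \<in> \<Omega>"
      show "(if t < u g \<and> (\<exists>s\<in>S. u (\<sigma> s g) \<le> t) then 1 else 0) \<le> (\<Sum>s\<in>S. ?I (u (\<sigma> s g)) (u g) t)"
      proof (cases "t < u g \<and> (\<exists>s\<in>S. u (\<sigma> s g) \<le> t)")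
        case True
        then obtain s where s: "s \<in> S" "u (\<sigma> s g) \<le> t" "t < u g" by blast
        then have "1 = ?I (u (\<sigma> s g)) (u g) t" by auto
        also have "\<dots> \<le> (\<Sum>s\<in>S. ?I (u (\<sigma> s g)) (u g) t)"
          using s fin by (intro member_le_sum) auto
        finally show ?thesis using True by simp
      next
        case False
        then show ?thesis using sum_nonneg[of S "\<lambda>s. ?I (u (\<sigma> s g)) (u g) t"] by auto
      qed
    qed
    finally show ?thesis .
  qed
  then have "(\<integral>t. c * (\<Sum>g\<in>\<Omega>. ?I 0 (u g) t) \<partial>lborel)
      \<le> (\<integral>t. (\<Sum>g\<in>\<Omega>. \<Sum>s\<in>S. ?I (u (\<sigma> s g)) (u g) t) \<partial>lborel)"
    by (intro integral_mono integrable_mult_right Bochner_Integration.integrable_sum int)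
  also have "(\<integral>t. c * (\<Sum>g\<in>\<Omega>. ?I 0 (u g) t) \<partial>lborel) = c * (\<Sum>g\<in>\<Omega>. u g)"
  proof -
    have "(\<integral>t. c * (\<Sum>g\<in>\<Omega>. ?I 0 (u g) t) \<partial>lborel) = c * (\<Sum>g\<in>\<Omega>. \<integral>t. ?I 0 (u g) t \<partial>lborel)"
      unfolding integral_mult_right_zero by (subst Bochner_Integration.integral_sum) (auto intro: int)
    then show ?thesis unfolding val using u by (simp add: max_def)
  qed
  also have "(\<integral>t. (\<Sum>g\<in>\<Omega>. \<Sum>s\<in>S. ?I (u (\<sigma> s g)) (u g) t) \<partial>lborel)
      = (\<Sum>g\<in>\<Omega>. \<Sum>s\<in>S. \<integral>t. ?I (u (\<sigma> s g)) (u g) t \<partial>lborel)"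
    by (subst Bochner_Integration.integral_sum,
        (intro Bochner_Integration.integrable_sum int)[1],
        intro sum.cong refl Bochner_Integration.integral_sum int)
  also have "\<dots> \<le> (\<Sum>g\<in>\<Omega>. \<Sum>s\<in>S. \<bar>u g - u (\<sigma> s g)\<bar>)"
    by (intro sum_mono le)
  finally show ?thesis .
qed

context group
begin

lemma symmetric_pmf_of_generators:
  assumes S: "finite S" "S \<subseteq> carrier G" "\<forall>s\<in>S. inv s \<in> S"
  shows "symmetric_pmf G (pmf_of_set (insert \<one> S))"
  unfolding symmetric_pmf_def
proof
  fix g assume g: "g \<in> carrier G"
  have "inv h \<in> insert \<one> S" if "h \<in> insert \<one> S" for h using S that by auto
  from this[of g] this[of "inv g"] have "inv g \<in> insert \<one> S \<longleftrightarrow> g \<in> insert \<one> S"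
    unfolding inv_inv[OF g] by blast
  then show "pmf (pmf_of_set (insert \<one> S)) g = pmf (pmf_of_set (insert \<one> S)) (inv g)"
    using S(1) by (simp only: pmf_of_set finite_insert insert_not_empty indicator_def simp_thms)
qed

text \<open>The loss \<open>\<mu>\<^sup>*\<^sup>2\<^sup>m(e) - \<mu>\<^sup>*\<^sup>2\<^sup>m\<^sup>+\<^sup>2(e)\<close> is \<open>|f|\<^sup>2 - |\<mu> * f|\<^sup>2\<close>. At each \<open>g\<close>, \<open>\<mu> * f\<close> is the average of \<open>f\<close>
  over the translates \<open>s g\<close> with \<open>s \<in> S \<union> {e}\<close>, so this loss is a sum of variances; as the identity
  occurs among the translations, the variance controls the differences \<open>f g - f (s g)\<close>. The set
  \<open>\<Omega>\<close> contains the support of \<open>f\<close> and all its translates by \<open>S\<close>, hence all sums are finite.\<close>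

lemma dirichlet_form_le:
  fixes S :: "'a set" and m :: nat
  defines "\<mu> \<equiv> pmf_of_set (insert \<one> S)" and "N \<equiv> real (card (insert \<one> S))"
  defines "f \<equiv> pmf (convolution_power G \<mu> m)"
    and "\<Omega> \<equiv> set_pmf (convolution_power G \<mu> (Suc m))"
  assumes S: "finite S" "S \<subseteq> carrier G" "\<forall>s\<in>S. inv s \<in> S"
  shows "(\<Sum>g\<in>\<Omega>. \<Sum>s\<in>S. (f g - f (s \<otimes> g))\<^sup>2)
    \<le> 2 * N * (1 + N) * (pmf (convolution_power G \<mu> (2 * m)) \<one>
                         - pmf (convolution_power G \<mu> (2 * Suc m)) \<one>)"
    and "(\<Sum>g\<in>\<Omega>. (f g)\<^sup>2) = pmf (convolution_power G \<mu> (2 * m)) \<one>"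
    and "\<And>g. f g \<noteq> 0 \<Longrightarrow> g \<in> \<Omega>"
proof -
  define T where "T = insert \<one> S"
  have T: "finite T" "T \<noteq> {}" "T \<subseteq> carrier G" "\<And>s. s \<in> T \<Longrightarrow> inv s \<in> T" "\<one> \<in> T" "S \<subseteq> T"
    using S by (auto simp: T_def)
  have \<mu>: "\<mu> = pmf_of_set T" "set_pmf \<mu> = T" and N: "N = real (card T)" and N1: "N \<ge> 1"
    using T by (auto simp: \<mu>_def T_def N_def Suc_le_eq card_gt_0_iff)
  have \<mu>s: "pmf \<mu> s = 1 / N" if "s \<in> T" for s
    using that T by (simp add: \<mu> N)
  have sym: "symmetric_pmf G \<mu>"
    unfolding \<mu>_def by (rule symmetric_pmf_of_generators[OF S])
  have sm: "set_pmf \<mu> \<subseteq> carrier G" "finite (set_pmf \<mu>)" using T \<mu> by auto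
  note rp = return_probability_eq_sum_squares[OF sm sym]
  define W where "W = set_pmf (convolution_power G \<mu> m)"
  have W: "W \<subseteq> carrier G" "finite W" 
    unfolding W_def using convolution_power_carrier[OF sm(1)] finite_convolution_power[OF sm(2)] by auto
  have fW: "f g \<noteq> 0 \<longleftrightarrow> g \<in> W" for g unfolding f_def W_def by (simp add: set_pmf_iff)
  have \<Omega>c: "\<Omega> \<subseteq> carrier G" "finite \<Omega>"
    unfolding \<Omega>_def using convolution_power_carrier[OF sm(1)] finite_convolution_power[OF sm(2)] by blast+
  have \<Omega>: "\<Omega> = (\<lambda>(g, h). g \<otimes> h) ` (T \<times> W)"
    unfolding \<Omega>_def convolution_power_Suc_left[OF sm(1)] set_convolution \<mu>(2) W_def ..
  have in\<Omega>: "g \<in> \<Omega>" if "s \<in> T" "g \<in> carrier G" "s \<otimes> g \<in> W" for s g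
  proof -
    have "s \<in> carrier G" using that T by auto
    then have "inv s \<otimes> (s \<otimes> g) = g" using that by (simp add: m_assoc[symmetric])
    then show ?thesis using that T(4)
      unfolding \<Omega> by (intro image_eqI[of _ _ "(inv s, s \<otimes> g)"]) auto
  qed
  show "\<And>g. f g \<noteq> 0 \<Longrightarrow> g \<in> \<Omega>"
    using in\<Omega>[of \<one>] fW T W by auto
  have shift: "(\<Sum>g\<in>\<Omega>. (f (s \<otimes> g))\<^sup>2) = (\<Sum>g\<in>W. (f g)\<^sup>2)" if s: "s \<in> T" for s
  proof -
    have sc: "s \<in> carrier G" using s T by auto
    have "(\<Sum>g\<in>\<Omega>. (f (s \<otimes> g))\<^sup>2) = (\<Sum>g\<in>{g\<in>\<Omega>. s \<otimes> g \<in> W}. (f (s \<otimes> g))\<^sup>2)"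
      using \<Omega>c fW by (intro sum.mono_neutral_right) auto
    also have "\<dots> = (\<Sum>g\<in>W. (f g)\<^sup>2)"
    proof (rule sum.reindex_bij_witness[of _ "\<lambda>h. inv s \<otimes> h" "\<lambda>g. s \<otimes> g"])
      fix h assume "h \<in> W"
      then have h: "h \<in> carrier G" "h \<in> W" using W by auto
      then have "s \<otimes> (inv s \<otimes> h) = h" using sc by (simp add: m_assoc[symmetric])
      then show "inv s \<otimes> h \<in> {g\<in>\<Omega>. s \<otimes> g \<in> W}" "s \<otimes> (inv s \<otimes> h) = h"
        using h in\<Omega>[OF s, of "inv s \<otimes> h"] sc by simp_all
    next
      fix g assume g: "g \<in> {g\<in>\<Omega>. s \<otimes> g \<in> W}"
      then show "inv s \<otimes> (s \<otimes> g) = g" using \<Omega>c sc by (simp add: m_assoc[symmetric] subset_iff)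
      show "s \<otimes> g \<in> W" using g by simp
    qed simp
    finally show ?thesis .
  qed
  have a: "(\<Sum>g\<in>W. (f g)\<^sup>2) = pmf (convolution_power G \<mu> (2 * m)) \<one>"
    unfolding rp f_def W_def ..
  have "(\<Sum>g\<in>\<Omega>. (f g)\<^sup>2) = (\<Sum>g\<in>\<Omega>. (f (\<one> \<otimes> g))\<^sup>2)"
    using \<Omega>c by (intro sum.cong refl) auto
  then show "(\<Sum>g\<in>\<Omega>. (f g)\<^sup>2) = pmf (convolution_power G \<mu> (2 * m)) \<one>"
    using shift[of \<one>] a T by simp
  define q where "q g = (\<Sum>s\<in>T. f (s \<otimes> g)) / N" for g
  have q: "pmf (convolution_power G \<mu> (Suc m)) g = q g" if g: "g \<in> \<Omega>" for g
  proof -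
    have gc: "g \<in> carrier G" using g \<Omega>c by auto
    have "pmf (convolution_power G \<mu> (Suc m)) g = (\<Sum>s\<in>T. pmf \<mu> s * f (inv s \<otimes> g))"
      unfolding convolution_power_Suc_left[OF sm(1)] f_def \<mu>(2)[symmetric]
      by (rule pmf_convolution) (use sm gc convolution_power_carrier[OF sm(1)] in auto)
    also have "\<dots> = (\<Sum>s\<in>T. f (inv s \<otimes> g) / N)"
      by (intro sum.cong refl) (simp add: \<mu>s)
    also have "\<dots> = (\<Sum>s\<in>T. f (s \<otimes> g) / N)"
      by (rule sum.reindex_bij_witness[of _ "\<lambda>s. inv s" "\<lambda>s. inv s"]) (use T in auto)
    finally show ?thesis unfolding q_def by (simp add: sum_divide_distrib)
  qed
  have b: "(\<Sum>g\<in>\<Omega>. (q g)\<^sup>2) = pmf (convolution_power G \<mu> (2 * Suc m)) \<one>"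
    unfolding rp \<Omega>_def[symmetric] by (intro sum.cong refl) (simp only: q)
  define V where "V g = (\<Sum>s\<in>T. (f (s \<otimes> g) - q g)\<^sup>2)" for g
  have V: "V g = (\<Sum>s\<in>T. (f (s \<otimes> g))\<^sup>2) - N * (q g)\<^sup>2" for g
  proof -
    have "V g = (\<Sum>s\<in>T. (f (s \<otimes> g))\<^sup>2) - 2 * q g * (\<Sum>s\<in>T. f (s \<otimes> g)) + N * (q g)\<^sup>2"
      unfolding V_def power2_diff by (simp add: sum.distrib sum_subtractf sum_distrib_left N algebra_simps)
    also have "(\<Sum>s\<in>T. f (s \<otimes> g)) = N * q g" unfolding q_def using N1 by simp
    finally show ?thesis by (simp add: power2_eq_square)
  qed
  have sumV: "(\<Sum>g\<in>\<Omega>. V g) = N * (pmf (convolution_power G \<mu> (2 * m)) \<one>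
                         - pmf (convolution_power G \<mu> (2 * Suc m)) \<one>)"
  proof -
    have "(\<Sum>g\<in>\<Omega>. V g) = (\<Sum>s\<in>T. \<Sum>g\<in>\<Omega>. (f (s \<otimes> g))\<^sup>2) - N * (\<Sum>g\<in>\<Omega>. (q g)\<^sup>2)"
      unfolding V sum_subtractf by (simp add: sum_distrib_left sum.swap[of _ \<Omega>])
    then show ?thesis using shift a b by (simp add: N algebra_simps)
  qed
  have "(\<Sum>s\<in>S. (f g - f (s \<otimes> g))\<^sup>2) \<le> 2 * (1 + N) * V g" if g: "g \<in> \<Omega>" for g
  proof -
    have gc: "\<one> \<otimes> g = g" using g \<Omega>c by auto
    have "(\<Sum>s\<in>S. (f g - f (s \<otimes> g))\<^sup>2) \<le> (\<Sum>s\<in>T. (f g - f (s \<otimes> g))\<^sup>2)"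
      using T by (intro sum_mono2) auto
    also have "\<dots> \<le> (\<Sum>s\<in>T. 2 * (f (\<one> \<otimes> g) - q g)\<^sup>2 + 2 * (f (s \<otimes> g) - q g)\<^sup>2)"
    proof (rule sum_mono)
      fix s
      show "(f g - f (s \<otimes> g))\<^sup>2 \<le> 2 * (f (\<one> \<otimes> g) - q g)\<^sup>2 + 2 * (f (s \<otimes> g) - q g)\<^sup>2"
        unfolding gc using sum_squares_bound[of "f g - q g" "- (f (s \<otimes> g) - q g)"]
        by (simp add: power2_eq_square algebra_simps)
    qed
    also have "\<dots> = 2 * N * (f (\<one> \<otimes> g) - q g)\<^sup>2 + 2 * V g"
      unfolding V_def sum.distrib by (simp add: N sum_distrib_left)
    also have "(f (\<one> \<otimes> g) - q g)\<^sup>2 \<le> V g"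
      unfolding V_def using T by (intro member_le_sum[of \<one> T "\<lambda>s. (f (s \<otimes> g) - q g)\<^sup>2"]) auto
    finally show ?thesis using N1 by (simp add: algebra_simps)
  qed
  then have "(\<Sum>g\<in>\<Omega>. \<Sum>s\<in>S. (f g - f (s \<otimes> g))\<^sup>2) \<le> (\<Sum>g\<in>\<Omega>. 2 * (1 + N) * V g)"
    by (rule sum_mono)
  also have "\<dots> = 2 * (1 + N) * (\<Sum>g\<in>\<Omega>. V g)" by (simp add: sum_distrib_left)
  finally show "(\<Sum>g\<in>\<Omega>. \<Sum>s\<in>S. (f g - f (s \<otimes> g))\<^sup>2)
    \<le> 2 * N * (1 + N) * (pmf (convolution_power G \<mu> (2 * m)) \<one>
                         - pmf (convolution_power G \<mu> (2 * Suc m)) \<one>)"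
    unfolding sumV by (simp add: algebra_simps)
qed

lemma abs_diff_squares_le:
  fixes x y \<theta> :: real
  assumes "\<theta> > 0"
  shows "\<bar>x\<^sup>2 - y\<^sup>2\<bar> \<le> (x - y)\<^sup>2 / (2 * \<theta>) + \<theta> * (x\<^sup>2 + y\<^sup>2)"
proof -
  have "0 \<le> (\<bar>x - y\<bar> / \<theta> - \<bar>x + y\<bar>)\<^sup>2 * (\<theta> / 2)" using assms by simp
  also have "\<dots> = (x - y)\<^sup>2 / (2 * \<theta>) + \<theta> / 2 * (x + y)\<^sup>2 - \<bar>x - y\<bar> * \<bar>x + y\<bar>"
    using assms unfolding power2_diff by (simp add: field_simps power2_eq_square)
  also have "\<bar>x - y\<bar> * \<bar>x + y\<bar> = \<bar>x\<^sup>2 - y\<^sup>2\<bar>"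
    by (simp add: abs_mult[symmetric] power2_eq_square algebra_simps)
  finally have "\<bar>x\<^sup>2 - y\<^sup>2\<bar> \<le> (x - y)\<^sup>2 / (2 * \<theta>) + \<theta> / 2 * (x + y)\<^sup>2" by simp
  also have "(x + y)\<^sup>2 \<le> 2 * (x\<^sup>2 + y\<^sup>2)"
    using sum_squares_bound[of x y] by (simp add: power2_sum)
  finally show ?thesis using assms by (simp add: mult_left_mono algebra_simps)
qed

text \<open>Cheeger's argument. The function \<open>f = \<mu>\<^sup>*\<^sup>m\<close> has \<open>|f|\<^sup>2 = a\<close> and total mass one. Cutting it off
  at height \<open>a/4\<close> leaves at least half of the squared norm, does not increase differences, and
  makes the support at most \<open>4/a\<close> elements large. If every level set of the square \<open>u\<close> of the
  truncation had boundary ratio above \<open>1/n\<close>, the coarea inequality would contradict the smallness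
  of the Dirichlet energy.\<close>

theorem foelner_set_of_slow_decay:
  fixes S :: "'a set" and m n :: nat
  defines "\<mu> \<equiv> pmf_of_set (insert \<one> S)" and "N \<equiv> real (card (insert \<one> S))"
  defines "a \<equiv> pmf (convolution_power G \<mu> (2 * m)) \<one>"
    and "b \<equiv> pmf (convolution_power G \<mu> (2 * Suc m)) \<one>"
  assumes S: "finite S" "S \<subseteq> carrier G" "\<forall>s\<in>S. inv s \<in> S"
    and n: "n \<ge> 1"
    and decay: "a - b \<le> a / (32 * N\<^sup>2 * (1 + N) * (real n)\<^sup>2)"
  shows "\<exists>F\<subseteq>carrier G. finite F \<and> F \<noteq> {} \<and>
    real (card (inner_boundary G S F)) \<le> 1 / real n * real (card F) \<and> real (card F) \<le> 4 / a"
proof -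
  define f where "f = pmf (convolution_power G \<mu> m)"
  define \<Omega> where "\<Omega> = set_pmf (convolution_power G \<mu> (Suc m))"
  note D = dirichlet_form_le[where m = m, OF S, folded \<mu>_def N_def, folded f_def \<Omega>_def a_def b_def]
  have sym: "symmetric_pmf G \<mu>" unfolding \<mu>_def by (rule symmetric_pmf_of_generators[OF S])
  have sm: "set_pmf \<mu> \<subseteq> carrier G" "finite (set_pmf \<mu>)" using S by (auto simp: \<mu>_def)
  have \<Omega>: "\<Omega> \<subseteq> carrier G" "finite \<Omega>"
    unfolding \<Omega>_def using convolution_power_carrier[OF sm(1)] finite_convolution_power[OF sm(2)] by blast+
  have a: "a > 0" unfolding a_def by (rule return_probability_pos[OF sm sym])
  have N1: "N \<ge> 1" using S by (simp add: N_def Suc_le_eq card_gt_0_iff)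
  have SN: "real (card S) \<le> N" using S by (simp add: N_def card_insert_le)
  define h where "h g = max 0 (f g - a / 4)" for g
  define u where "u g = (h g)\<^sup>2" for g
  have f0: "f g \<ge> 0" for g by (simp add: f_def)
  have sumf: "(\<Sum>g\<in>F. f g) \<le> 1" if "finite F" for F
    using that by (simp add: f_def measure_measure_pmf_finite[symmetric])
  have sumu: "a / 2 \<le> (\<Sum>g\<in>\<Omega>. u g)"
  proof -
    have "(f g)\<^sup>2 - a / 2 * f g \<le> u g" for g
    proof (cases "f g \<ge> a / 4")
      case True
      then show ?thesis by (simp add: u_def h_def power2_eq_square algebra_simps)
    next
      case False
      then have "f g * (f g - a / 2) \<le> 0" using f0[of g] a by (intro mult_nonneg_nonpos) auto
      then show ?thesis using False by (simp add: u_def h_def power2_eq_square algebra_simps)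
    qed
    then have "(\<Sum>g\<in>\<Omega>. (f g)\<^sup>2 - a / 2 * f g) \<le> (\<Sum>g\<in>\<Omega>. u g)" by (rule sum_mono)
    moreover have "(\<Sum>g\<in>\<Omega>. (f g)\<^sup>2 - a / 2 * f g) = a - a / 2 * (\<Sum>g\<in>\<Omega>. f g)"
      unfolding sum_subtractf D(2) by (simp add: sum_distrib_left)
    moreover have "a / 2 * (\<Sum>g\<in>\<Omega>. f g) \<le> a / 2 * 1"
      using a by (intro mult_left_mono sumf \<Omega>) auto
    ultimately show ?thesis by linarith
  qed
  define F where "F t = {g\<in>\<Omega>. t < u g}" for t
  define bd where "bd t = {g\<in>\<Omega>. t < u g \<and> (\<exists>s\<in>S. u (s \<otimes> g) \<le> t)}" for t
  have "\<exists>t\<ge>0. F t \<noteq> {} \<and> real (card (bd t)) \<le> 1 / real n * real (card (F t))"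
  proof (rule ccontr)
    assume "\<not> ?thesis"
    then have "1 / real n * real (card (F t)) \<le> real (card (bd t))" if "t \<ge> 0" for t
      using that by (cases "F t = {}") force+
    then have "1 / real n * (\<Sum>g\<in>\<Omega>. u g) \<le> (\<Sum>g\<in>\<Omega>. \<Sum>s\<in>S. \<bar>u g - u (s \<otimes> g)\<bar>)"
      by (intro coarea_inequality \<Omega> S) (simp_all add: u_def[of _] F_def bd_def)
    also have "\<dots> \<le> 3 / (4 * real n) * (\<Sum>g\<in>\<Omega>. u g)"
    proof -
      \<comment> \<open>With this weight the two terms of the next estimate are at most \<open>1/(2n)\<close> and
        \<open>1/(4n)\<close> times the sum of \<open>u\<close>, which adds up to less than \<open>1/n\<close>.\<close>
      define \<theta> where "\<theta> = 1 / (8 * N * real n)"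
      have \<theta>: "\<theta> > 0" using N1 n by (simp add: \<theta>_def)
      have hf: "(h g - h g')\<^sup>2 \<le> (f g - f g')\<^sup>2" for g g'
        by (rule abs_le_square_iff[THEN iffD1]) (auto simp: h_def abs_if max_def)
      have *: "\<bar>u g - u g'\<bar> \<le> (f g - f g')\<^sup>2 / (2 * \<theta>) + \<theta> * (u g + u g')" for g g'
      proof -
        have "\<bar>u g - u g'\<bar> \<le> (h g - h g')\<^sup>2 / (2 * \<theta>) + \<theta> * (u g + u g')"
          unfolding u_def by (rule abs_diff_squares_le[OF \<theta>])
        also have "(h g - h g')\<^sup>2 / (2 * \<theta>) \<le> (f g - f g')\<^sup>2 / (2 * \<theta>)"
          using \<theta> by (intro divide_right_mono hf) auto
        finally show ?thesis by simp
      qed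
      have us: "(\<Sum>g\<in>\<Omega>. u (s \<otimes> g)) \<le> (\<Sum>g\<in>\<Omega>. u g)" if s: "s \<in> S" for s
      proof -
        have sc: "s \<in> carrier G" using s S by auto
        have inj: "inj_on (\<lambda>g. s \<otimes> g) {g\<in>\<Omega>. u (s \<otimes> g) \<noteq> 0}"
          using \<Omega> sc by (intro inj_onI) (auto simp: subset_iff)
        have nz: "f g \<noteq> 0" if "u g \<noteq> 0" for g
          using that a by (auto simp: u_def h_def max_def split: if_splits)
        have "(\<Sum>g\<in>\<Omega>. u (s \<otimes> g)) = (\<Sum>g\<in>{g\<in>\<Omega>. u (s \<otimes> g) \<noteq> 0}. u (s \<otimes> g))"
          using \<Omega> by (intro sum.mono_neutral_right) auto
        also have "\<dots> = (\<Sum>g\<in>(\<lambda>g. s \<otimes> g) ` {g\<in>\<Omega>. u (s \<otimes> g) \<noteq> 0}. u g)"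
          by (rule sum.reindex_cong[OF inj refl refl, symmetric])
        also have "\<dots> \<le> (\<Sum>g\<in>\<Omega>. u g)"
          using \<Omega> nz D(3) by (intro sum_mono2) (auto simp: u_def[of _])
        finally show ?thesis .
      qed
      have "(\<Sum>g\<in>\<Omega>. \<Sum>s\<in>S. \<bar>u g - u (s \<otimes> g)\<bar>)
          \<le> (\<Sum>g\<in>\<Omega>. \<Sum>s\<in>S. (f g - f (s \<otimes> g))\<^sup>2 / (2 * \<theta>) + \<theta> * (u g + u (s \<otimes> g)))"
        by (intro sum_mono *)
      also have "\<dots> = (\<Sum>g\<in>\<Omega>. \<Sum>s\<in>S. (f g - f (s \<otimes> g))\<^sup>2) / (2 * \<theta>)
          + \<theta> * (\<Sum>g\<in>\<Omega>. \<Sum>s\<in>S. u g + u (s \<otimes> g))"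
        by (simp add: sum.distrib sum_divide_distrib sum_distrib_left distrib_left mult_ac)
      also have "(\<Sum>g\<in>\<Omega>. \<Sum>s\<in>S. u g + u (s \<otimes> g))
          = (\<Sum>s\<in>S. (\<Sum>g\<in>\<Omega>. u g) + (\<Sum>g\<in>\<Omega>. u (s \<otimes> g)))"
        by (subst sum.swap) (simp only: sum.distrib)
      also have "\<dots> \<le> (\<Sum>s\<in>S. 2 * (\<Sum>g\<in>\<Omega>. u g))"
        using us by (intro sum_mono) fastforce
      also have "\<dots> \<le> 2 * N * (\<Sum>g\<in>\<Omega>. u g)"
        using SN sumu a by (simp add: mult_right_mono)
      also have "(\<Sum>g\<in>\<Omega>. \<Sum>s\<in>S. (f g - f (s \<otimes> g))\<^sup>2) \<le> 2 * N * (1 + N) * (a - b)"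
        by (rule D(1))
      also have "\<dots> \<le> 2 * N * (1 + N) * (a / (32 * N\<^sup>2 * (1 + N) * (real n)\<^sup>2))"
        using N1 by (intro mult_left_mono decay) auto
      also have "\<dots> = a / (16 * N * (real n)\<^sup>2)"
      proof -
        have "2 * N * P * (a / (32 * N\<^sup>2 * P * (real n)\<^sup>2)) = a / (16 * N * (real n)\<^sup>2)"
          if "P > 0" for P
          using that N1 n by (simp add: field_simps power2_eq_square)
        from this[of "1 + N"] show ?thesis using N1 by argo
      qed
      finally have "(\<Sum>g\<in>\<Omega>. \<Sum>s\<in>S. \<bar>u g - u (s \<otimes> g)\<bar>)
          \<le> a / (16 * N * (real n)\<^sup>2) / (2 * \<theta>) + \<theta> * (2 * N * (\<Sum>g\<in>\<Omega>. u g))"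
        using \<theta> by (simp add: divide_right_mono)
      also have "a / (16 * N * (real n)\<^sup>2) / (2 * \<theta>) = 1 / (2 * real n) * (a / 2)"
        using N1 n by (simp add: \<theta>_def field_simps power2_eq_square)
      also have "\<dots> \<le> 1 / (2 * real n) * (\<Sum>g\<in>\<Omega>. u g)"
        using sumu by (intro mult_left_mono) auto
      also have "\<theta> * (2 * N * (\<Sum>g\<in>\<Omega>. u g)) = 1 / (4 * real n) * (\<Sum>g\<in>\<Omega>. u g)"
        using N1 n by (simp add: \<theta>_def field_simps)
      finally show ?thesis using n by (simp add: field_simps)
    qed
    finally have "1 / real n * (\<Sum>g\<in>\<Omega>. u g) \<le> 3 / (4 * real n) * (\<Sum>g\<in>\<Omega>. u g)" .
    moreover have "(\<Sum>g\<in>\<Omega>. u g) > 0" using sumu a by linarith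
    ultimately show False using n by (simp add: field_simps)
  qed
  then obtain t where t: "t \<ge> 0" "F t \<noteq> {}" "real (card (bd t)) \<le> 1 / real n * real (card (F t))"
    by blast
  have Ff: "finite (F t)" "F t \<subseteq> carrier G" using \<Omega> by (auto simp: F_def)
  have "inner_boundary G S (F t) \<subseteq> bd t"
  proof
    fix g assume "g \<in> inner_boundary G S (F t)"
    then obtain s where s: "g \<in> F t" "s \<in> S" "s \<otimes> g \<notin> F t" unfolding inner_boundary_def by blast
    have "u (s \<otimes> g) \<le> t"
    proof (cases "s \<otimes> g \<in> \<Omega>")
      case True then show ?thesis using s by (auto simp: F_def)
    next
      case False
      then have "f (s \<otimes> g) = 0" using D(3) by blast
      then show ?thesis using a t by (simp add: u_def h_def)
    qed
    then show "g \<in> bd t" using s by (auto simp: F_def bd_def)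
  qed
  then have "card (inner_boundary G S (F t)) \<le> card (bd t)"
    using \<Omega> by (intro card_mono) (auto simp: bd_def)
  then have 1: "real (card (inner_boundary G S (F t))) \<le> 1 / real n * real (card (F t))"
    using t(3) by linarith
  have "real (card (F t)) * (a / 4) \<le> (\<Sum>g\<in>F t. f g)"
  proof (rule sum_bounded_below)
    fix g assume "g \<in> F t"
    then have "u g > 0" using t by (auto simp: F_def)
    then show "a / 4 \<le> f g" by (auto simp: u_def h_def max_def split: if_splits)
  qed
  then have "real (card (F t)) * (a / 4) \<le> 1" using sumf[OF Ff(1)] by linarith
  then have 2: "real (card (F t)) \<le> 4 / a" using a by (simp add: field_simps)
  show ?thesis using Ff t(2) 1 2 by blast
qed

end

section \<open>Orbit cocycles of the topological full group\<close>

lemma shift_pow_0 [simp]: "shift_pow 0 x = x"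
  by (simp add: shift_pow_eq)

lemma shift_pow_add: "shift_pow (a + b) x = shift_pow a (shift_pow b x)"
  by (simp add: shift_pow_eq algebra_simps)

definition agree_upto :: "nat \<Rightarrow> (int \<Rightarrow> 'a) \<Rightarrow> (int \<Rightarrow> 'a) \<Rightarrow> bool" where
  "agree_upto m x y \<longleftrightarrow> (\<forall>i. \<bar>i\<bar> \<le> int m \<longrightarrow> x i = y i)"

lemma agree_upto_mono: "agree_upto m x y \<Longrightarrow> l \<le> m \<Longrightarrow> agree_upto l x y"
  by (auto simp: agree_upto_def)

lemma agree_upto_trans: "agree_upto m x y \<Longrightarrow> agree_upto m y z \<Longrightarrow> agree_upto m x z"
  by (auto simp: agree_upto_def)

lemma agree_upto_shift_pow:
  "agree_upto (m + n) x y \<Longrightarrow> \<bar>i\<bar> \<le> int n \<Longrightarrow> agree_upto m (shift_pow i x) (shift_pow i y)"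
  by (auto simp: agree_upto_def shift_pow_eq)

definition local_on :: "(int \<Rightarrow> 'a) set \<Rightarrow> nat \<Rightarrow> ((int \<Rightarrow> 'a) \<Rightarrow> 'c) \<Rightarrow> bool" where
  "local_on X m k \<longleftrightarrow> (\<forall>x\<in>X. \<forall>y\<in>X. agree_upto m x y \<longrightarrow> k x = k y)"

locale subshift_space =
  fixes A :: "'a set" and X :: "(int \<Rightarrow> 'a) set"
  assumes subshift: "subshift A X"
begin

abbreviation "top_X \<equiv> subshift_topology A X"
abbreviation "\<G> \<equiv> topological_full_group A X"
abbreviation "continuous_cocycle k \<equiv> continuous_map top_X (discrete_topology (UNIV :: int set)) k"

lemma finite_alphabet: "finite A"
  using subshift by (simp add: subshift_def)

lemma topspace_full: "topspace (full_shift_topology A) = {x. \<forall>i. x i \<in> A}"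
  by (auto simp: full_shift_topology_def PiE_def Pi_def)

lemma X_in_alphabet: "x \<in> X \<Longrightarrow> x i \<in> A"
  using subshift closedin_subset[of "full_shift_topology A" X]
  by (auto simp: subshift_def topspace_full)

lemma topspace_X: "topspace top_X = X"
  using X_in_alphabet by (auto simp: subshift_topology_def topspace_full)

lemma compact_X: "compact_space top_X"
proof -
  have "compact_space (full_shift_topology A)"
    unfolding full_shift_topology_def
    by (simp add: compact_space_product_topology compact_space_discrete_topology finite_alphabet)
  then show ?thesis
    using subshift unfolding subshift_topology_def subshift_def
    by (simp add: closedin_compact_space compact_space_subtopology)
qed

lemma shift_invariant: "x \<in> X \<Longrightarrow> shift_pow k x \<in> X"
proof -
  have img: "shift ` X = X" using subshift by (simp add: subshift_def)
  have up: "shift x \<in> X" if "x \<in> X" for x using that img by blast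
  have down: "shift_pow (-1) x \<in> X" if x: "x \<in> X" for x
  proof -
    obtain y where "y \<in> X" "x = shift y" using x img by blast
    moreover have "shift_pow (-1) (shift y) = y" by (simp add: shift_pow_eq shift_def)
    ultimately show ?thesis by simp
  qed
  assume x: "x \<in> X"
  show ?thesis
  proof (induction k rule: int_induct[where k = 0])
    case base then show ?case using x by simp
  next
    case (step1 i)
    have "shift_pow (i + 1) x = shift (shift_pow i x)" by (simp add: shift_pow_eq shift_def algebra_simps)
    then show ?case using up step1 by simp
  next
    case (step2 i)
    have "shift_pow (i - 1) x = shift_pow (-1) (shift_pow i x)" by (simp add: shift_pow_eq algebra_simps)
    then show ?case using down step2 by simp
  qed
qed

lemma openin_cylinder: "openin top_X {y\<in>X. agree_upto m x y}"
proof (cases "{y\<in>X. agree_upto m x y} = {}")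
  case True
  then show ?thesis by (simp only: openin_empty)
next
  case False
  then obtain z where z: "z \<in> X" "agree_upto m x z" by blast
  let ?U = "PiE UNIV (\<lambda>i. if \<bar>i\<bar> \<le> int m then {z i} else A)"
  have "finite {i. \<bar>i\<bar> \<le> int m}" by (rule finite_subset[of _ "{- int m..int m}"]) auto
  then have "openin (full_shift_topology A) ?U"
    unfolding full_shift_topology_def using X_in_alphabet[OF z(1)]
    by (subst openin_PiE_gen) (auto elim!: rev_finite_subset)
  moreover have "{y\<in>X. agree_upto m x y} = ?U \<inter> X"
    using X_in_alphabet z by (auto simp: agree_upto_def PiE_def Pi_def split: if_splits)
  ultimately show ?thesis unfolding subshift_topology_def openin_subtopology by blast
qed

text \<open>The cylinders form a basis of the topology of \<open>X\<close>.\<close>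

lemma cylinder_in_open:
  assumes "openin top_X U" "x \<in> U"
  shows "\<exists>m. \<forall>y\<in>X. agree_upto m x y \<longrightarrow> y \<in> U"
proof -
  obtain V where V: "openin (full_shift_topology A) V" "U = V \<inter> X"
    using assms(1) unfolding subshift_topology_def openin_subtopology by blast
  obtain W where W: "finite {i. W i \<noteq> A}" "x \<in> PiE UNIV W" "PiE UNIV W \<subseteq> V"
    using V assms(2) unfolding full_shift_topology_def openin_product_topology_alt by fastforce
  define m where "m = Max (insert 0 ((\<lambda>i. nat \<bar>i\<bar>) ` {i. W i \<noteq> A}))"
  have m: "\<bar>i\<bar> \<le> int m" if "W i \<noteq> A" for i
  proof -
    have "nat \<bar>i\<bar> \<le> m" unfolding m_def using W(1) that by (intro Max_ge) auto
    then show ?thesis by simp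
  qed
  have "y \<in> U" if y: "y \<in> X" "agree_upto m x y" for y
  proof -
    have "y i \<in> W i" for i
    proof (cases "W i = A")
      case True then show ?thesis using X_in_alphabet y by simp
    next
      case False
      then have "y i = x i" using m[OF False] y by (simp add: agree_upto_def)
      then show ?thesis using W(2) by (simp add: PiE_def Pi_def)
    qed
    then show ?thesis using W(3) V y by (auto simp: PiE_def Pi_def)
  qed
  then show ?thesis by blast
qed

text \<open>A sliding block code: by compactness finitely many cylinders on which \<open>k\<close> is constant cover \<open>X\<close>,
  and the largest of their radii works everywhere.\<close>

lemma continuous_cocycle_iff_local: "continuous_cocycle k \<longleftrightarrow> (\<exists>m. local_on X m k)"
proof
  assume k: "continuous_cocycle k"
  have "\<exists>m. \<forall>y\<in>X. agree_upto m x y \<longrightarrow> k y = k x" if "x \<in> X" for x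
  proof -
    have "openin top_X {y\<in>topspace top_X. k y \<in> {k x}}"
      using k by (intro openin_continuous_map_preimage) auto
    moreover have "x \<in> {y\<in>topspace top_X. k y \<in> {k x}}" using that by (simp add: topspace_X)
    ultimately obtain l where "\<forall>y\<in>X. agree_upto l x y \<longrightarrow> y \<in> {y\<in>topspace top_X. k y \<in> {k x}}"
      using cylinder_in_open by meson
    then show ?thesis by (intro exI[of _ l]) simp
  qed
  then have "\<forall>x\<in>X. \<exists>m. \<forall>y\<in>X. agree_upto m x y \<longrightarrow> k y = k x" ..
  from bchoice[OF this] obtain m where "\<forall>x\<in>X. \<forall>y\<in>X. agree_upto (m x) x y \<longrightarrow> k y = k x" ..
  then have m: "\<And>x y. x \<in> X \<Longrightarrow> y \<in> X \<Longrightarrow> agree_upto (m x) x y \<Longrightarrow> k y = k x" by simp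
  let ?C = "\<lambda>x. {y\<in>X. agree_upto (m x) x y}"
  have "topspace top_X \<subseteq> \<Union>(?C ` X)" by (auto simp: topspace_X agree_upto_def)
  moreover have "Ball (?C ` X) (openin top_X)" using openin_cylinder by simp
  ultimately obtain \<F> where \<F>: "finite \<F>" "\<F> \<subseteq> ?C ` X" "topspace top_X \<subseteq> \<Union>\<F>"
    using compact_X[unfolded compact_space_alt, THEN spec[of _ "?C ` X"]] by (elim impE exE conjE) simp_all
  then obtain I where I: "finite I" "I \<subseteq> X" "\<F> = ?C ` I" using finite_subset_image[OF \<F>(1,2)] by (elim exE conjE) simp
  have "local_on X (Max (m ` I)) k"
    unfolding local_on_def
  proof (intro ballI impI)
    fix x y assume xy: "x \<in> X" "y \<in> X" "agree_upto (Max (m ` I)) x y"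
    have "x \<in> \<Union>(?C ` I)" using \<F>(3) I(3) xy(1) unfolding topspace_X by (rule_tac subsetD) simp_all
    then obtain z where z: "z \<in> I" "agree_upto (m z) z x" by (elim UN_E) simp
    have "m z \<le> Max (m ` I)" using z(1) I(1) by simp
    then have "agree_upto (m z) x y" using xy(3) agree_upto_mono by blast
    then have "agree_upto (m z) z y" using z agree_upto_trans by blast
    moreover have "z \<in> X" using z(1) I(2) by (rule_tac subsetD)
    ultimately show "k x = k y" using m[of z x] m[of z y] z(2) xy(1,2) by simp
  qed
  then show "\<exists>m. local_on X m k" ..
next
  assume "\<exists>m. local_on X m k"
  then obtain m where m: "local_on X m k" ..
  show "continuous_cocycle k"
    unfolding continuous_map_def
  proof (intro conjI allI impI)
    show "k \<in> topspace top_X \<rightarrow> topspace (discrete_topology UNIV)" by simp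
    fix U :: "int set"
    have "{x \<in> topspace top_X. k x \<in> U} = (\<Union>x\<in>{x\<in>X. k x \<in> U}. {y\<in>X. agree_upto m x y})"
    proof (intro equalityI subsetI)
      fix y assume "y \<in> {x \<in> topspace top_X. k x \<in> U}"
      then show "y \<in> (\<Union>x\<in>{x\<in>X. k x \<in> U}. {y\<in>X. agree_upto m x y})"
        by (auto simp: topspace_X agree_upto_def)
    next
      fix y assume "y \<in> (\<Union>x\<in>{x\<in>X. k x \<in> U}. {y\<in>X. agree_upto m x y})"
      then obtain x where x: "x \<in> X" "k x \<in> U" "y \<in> X" "agree_upto m x y" by blast
      then have "k x = k y" using m unfolding local_on_def by blast
      then show "y \<in> {x \<in> topspace top_X. k x \<in> U}" using x by (simp add: topspace_X)
    qed
    then show "openin top_X {x \<in> topspace top_X. k x \<in> U}"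
      using openin_cylinder by auto
  qed
qed

lemma continuous_cocycle_bounded:
  assumes "continuous_cocycle k"
  shows "\<exists>K::nat. \<forall>x\<in>X. \<bar>k x\<bar> \<le> int K"
proof -
  have "compactin (discrete_topology UNIV) (k ` topspace top_X)"
    using image_compactin[OF _ assms, of "topspace top_X"] compact_X unfolding compact_space_def by blast
  then have fin: "finite (k ` X)" by (simp add: topspace_X compactin_discrete_topology)
  have "\<bar>k x\<bar> \<le> int (\<Sum>j\<in>k ` X. nat \<bar>j\<bar>)" if "x \<in> X" for x
  proof -
    have "nat \<bar>k x\<bar> \<le> (\<Sum>j\<in>k ` X. nat \<bar>j\<bar>)"
      using that fin by (intro member_le_sum) auto
    then show ?thesis by linarith
  qed
  then show ?thesis by blast
qed

lemma full_group_iff: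
  "g \<in> carrier \<G> \<longleftrightarrow> g \<in> Bij X \<and> homeomorphic_map top_X top_X g \<and>
     (\<exists>k. continuous_cocycle k \<and> (\<forall>x\<in>X. g x = shift_pow (k x) x))"
  by (simp add: topological_full_group_def)

lemma full_group_mem: "g \<in> carrier \<G> \<Longrightarrow> x \<in> X \<Longrightarrow> g x \<in> X"
  using bij_betwE by (fastforce simp: full_group_iff Bij_def)

lemma full_group_mult [simp]:
  assumes "g \<in> carrier \<G>" "h \<in> carrier \<G>" "x \<in> X"
  shows "(g \<otimes>\<^bsub>\<G>\<^esub> h) x = g (h x)"
  using assms by (simp add: full_group_iff topological_full_group_def BijGroup_def compose_eq)

lemma full_group_one [simp]: "x \<in> X \<Longrightarrow> \<one>\<^bsub>\<G>\<^esub> x = x"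
  by (simp add: topological_full_group_def BijGroup_def)

lemma subgroup_full_group: "subgroup (carrier \<G>) (BijGroup X)"
proof (rule group.subgroupI[OF group_BijGroup])
  show "carrier \<G> \<subseteq> carrier (BijGroup X)" by (auto simp: full_group_iff BijGroup_def)
  have "(\<lambda>x\<in>X. x) \<in> carrier \<G>"
    unfolding full_group_iff
  proof (intro conjI exI[of _ "\<lambda>_. 0"])
    show "(\<lambda>x\<in>X. x) \<in> Bij X" by (rule id_Bij)
    show "homeomorphic_map top_X top_X (\<lambda>x\<in>X. x)"
      by (rule homeomorphic_map_eq[OF homeomorphic_map_id[THEN iffD2, OF refl]]) (simp add: topspace_X)
  qed auto
  then show "carrier \<G> \<noteq> {}" by blast
next
  fix g assume g: "g \<in> carrier \<G>"
  let ?g' = "\<lambda>x\<in>X. inv_into X g x"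
  have gB: "g \<in> Bij X" using g by (simp add: full_group_iff)
  have bij: "bij_betw g X X" using gB by (simp add: Bij_def)
  have inv1: "inv_into X g (g x) = x" if "x \<in> X" for x using bij that by (simp add: bij_betw_def)
  have inv2: "g (inv_into X g x) = x" "inv_into X g x \<in> X" if "x \<in> X" for x
    using bij that by (auto simp: bij_betw_def f_inv_into_f inv_into_into)
  obtain k where k: "continuous_cocycle k" "\<And>x. x \<in> X \<Longrightarrow> g x = shift_pow (k x) x"
    using g by (auto simp: full_group_iff)
  obtain h where "homeomorphic_maps top_X top_X g h"
    using g unfolding full_group_iff homeomorphic_map_maps by blast
  then have h: "homeomorphic_map top_X top_X h" "\<And>x. x \<in> X \<Longrightarrow> h (g x) = x" "\<And>x. x \<in> X \<Longrightarrow> g (h x) = x"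
    by (auto simp: homeomorphic_maps_map topspace_X)
  have hX: "h x \<in> X" if "x \<in> X" for x
    using that h(1) by (metis homeomorphic_imp_surjective_map imageI topspace_X)
  have eq: "inv_into X g x = h x" if "x \<in> X" for x
    using inv1[OF hX[OF that]] h(3)[OF that] by simp
  have "?g' \<in> carrier \<G>"
    unfolding full_group_iff
  proof (intro conjI exI[of _ "\<lambda>x. - k (h x)"])
    show "?g' \<in> Bij X" by (rule restrict_inv_into_Bij[OF gB])
    show "homeomorphic_map top_X top_X ?g'"
      by (rule homeomorphic_map_eq[OF h(1)]) (simp add: topspace_X eq)
    have "continuous_cocycle (k \<circ> h)"
      using h(1) k(1) homeomorphic_imp_continuous_map continuous_map_compose by blast
    then have "continuous_cocycle (uminus \<circ> (k \<circ> h))"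
      by (rule continuous_map_compose) simp
    then show "continuous_cocycle (\<lambda>x. - k (h x))" by (simp add: o_def)
    show "\<forall>x\<in>X. ?g' x = shift_pow (- k (h x)) x"
    proof
      fix x assume x: "x \<in> X"
      have "x = shift_pow (k (h x)) (h x)" using k(2)[OF hX[OF x]] h(3)[OF x] by simp
      then have "shift_pow (- k (h x)) x = shift_pow (- k (h x)) (shift_pow (k (h x)) (h x))" by simp
      also have "\<dots> = h x" by (simp flip: shift_pow_add)
      finally show "?g' x = shift_pow (- k (h x)) x" using x eq by simp
    qed
  qed
  then show "inv\<^bsub>BijGroup X\<^esub> g \<in> carrier \<G>" by (simp add: inv_BijGroup gB)
next
  fix g h assume gh: "g \<in> carrier \<G>" "h \<in> carrier \<G>"
  have B: "g \<in> Bij X" "h \<in> Bij X" using gh by (auto simp: full_group_iff)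
  obtain k l where k: "continuous_cocycle k" "\<And>x. x \<in> X \<Longrightarrow> g x = shift_pow (k x) x"
    and l: "continuous_cocycle l" "\<And>x. x \<in> X \<Longrightarrow> h x = shift_pow (l x) x"
    using gh by (auto simp: full_group_iff)
  have "compose X g h \<in> carrier \<G>"
    unfolding full_group_iff
  proof (intro conjI exI[of _ "\<lambda>x. k (h x) + l x"])
    show "compose X g h \<in> Bij X" by (rule compose_Bij[OF B])
    have "homeomorphic_map top_X top_X (g \<circ> h)"
      using gh unfolding full_group_iff by (blast intro: homeomorphic_map_compose)
    then show "homeomorphic_map top_X top_X (compose X g h)"
      by (rule homeomorphic_map_eq) (simp add: topspace_X compose_eq)
    have "continuous_cocycle (k \<circ> h)"
      using gh(2) k(1) unfolding full_group_iff by (blast intro: homeomorphic_imp_continuous_map continuous_map_compose)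
    then obtain m m' where m: "local_on X m (k \<circ> h)" "local_on X m' l"
      using l(1) by (auto simp: continuous_cocycle_iff_local)
    have "local_on X (max m m') (\<lambda>x. k (h x) + l x)"
      using m unfolding local_on_def o_def by (metis agree_upto_mono max.cobounded1 max.cobounded2)
    then show "continuous_cocycle (\<lambda>x. k (h x) + l x)" by (auto simp: continuous_cocycle_iff_local)
    show "\<forall>x\<in>X. compose X g h x = shift_pow (k (h x) + l x) x"
      using k(2) l(2) full_group_mem[OF gh(2)] by (auto simp: compose_eq shift_pow_add)
  qed
  then show "g \<otimes>\<^bsub>BijGroup X\<^esub> h \<in> carrier \<G>" using B by (simp add: BijGroup_def)
qed

sublocale full_group: group \<G>
proof -
  have "\<G> = BijGroup X\<lparr>carrier := carrier \<G>\<rparr>" by (simp add: topological_full_group_def)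
  then show "group \<G>" using subgroup.subgroup_is_group[OF subgroup_full_group group_BijGroup] by simp
qed

definition cocycle :: "((int \<Rightarrow> 'a) \<Rightarrow> (int \<Rightarrow> 'a)) \<Rightarrow> (int \<Rightarrow> 'a) \<Rightarrow> int" where
  "cocycle g = (SOME k. continuous_cocycle k \<and> (\<forall>x\<in>X. g x = shift_pow (k x) x))"

lemma cocycle:
  assumes "g \<in> carrier \<G>"
  shows "continuous_cocycle (cocycle g)" "x \<in> X \<Longrightarrow> g x = shift_pow (cocycle g x) x"
  using someI_ex[of "\<lambda>k. continuous_cocycle k \<and> (\<forall>x\<in>X. g x = shift_pow (k x) x)"] assms
  unfolding cocycle_def full_group_iff by blast+

end

locale nonisolated_subshift = subshift_space +
  assumes no_isolated: "no_isolated_periodic_points A X"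
begin

text \<open>Near a point where the two functions differ by \<open>d\<close>, every point is \<open>d\<close>-periodic and hence
  determined by the coordinates in one period. A small cylinder then contains a single, periodic
  point, which would be isolated.\<close>

lemma cocycle_unique:
  assumes k: "continuous_cocycle k" "continuous_cocycle l"
    and eq: "\<And>x. x \<in> X \<Longrightarrow> shift_pow (k x) x = shift_pow (l x) x" and x: "x \<in> X"
  shows "k x = l x"
proof (rule ccontr)
  assume neq: "k x \<noteq> l x"
  define d where "d = nat \<bar>k x - l x\<bar>"
  have d: "d \<ge> 1" using neq by (simp add: d_def)
  obtain m m' where m: "local_on X m k" "local_on X m' l"
    using k by (auto simp: continuous_cocycle_iff_local)
  define M where "M = max d (max m m')"
  have periodic: "y (i + int d) = y i" if y: "y \<in> X" "agree_upto M x y" for y i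
  proof -
    have "k y = k x" "l y = l x"
      using m x y agree_upto_mono[of M x y] unfolding local_on_def M_def by (metis max.cobounded1 max.cobounded2 max.coboundedI2)+
    then have e: "y (j + k x) = y (j + l x)" for j
      using eq[OF y(1)] by (simp add: shift_pow_eq fun_eq_iff)
    show ?thesis
    proof (cases "k x \<ge> l x")
      case True
      then show ?thesis using e[of "i - l x"] by (simp add: d_def algebra_simps)
    next
      case False
      then show ?thesis using e[of "i - k x"] by (simp add: d_def algebra_simps)
    qed
  qed
  have periodic_mod: "y i = y (i mod int d)" if y: "y \<in> X" "agree_upto M x y" for y i
  proof -
    have "y (j + int d * int n) = y j" for j n
    proof (induction n)
      case (Suc n)
      then show ?case using periodic[OF y, of "j + int d * int n"] by (simp add: algebra_simps)
    qed simp
    note P = this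
    have Q: "y (j + int d * q) = y j" for j q
    proof (cases "q \<ge> 0")
      case True then show ?thesis using P[of j "nat q"] by simp
    next
      case False then show ?thesis using P[of "j + int d * q" "nat (- q)"] by simp
    qed
    show ?thesis using Q[of "i mod int d" "i div int d"] by simp
  qed
  have "{y\<in>X. agree_upto M x y} = {x}"
  proof (intro equalityI subsetI)
    fix y assume "y \<in> {y\<in>X. agree_upto M x y}"
    then have y: "y \<in> X" "agree_upto M x y" by auto
    have "y i = x i" for i
    proof -
      have "0 \<le> i mod int d" "i mod int d < int d" using d by simp_all
      moreover have "d \<le> M" by (simp add: M_def)
      ultimately have "\<bar>i mod int d\<bar> \<le> int M" by linarith
      then have "x (i mod int d) = y (i mod int d)" using y by (simp add: agree_upto_def)
      moreover have "agree_upto M x x" by (simp add: agree_upto_def)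
      ultimately show ?thesis using periodic_mod[OF y] periodic_mod[OF x] by metis
    qed
    then show "y \<in> {x}" by auto
  qed (use x in \<open>auto simp: agree_upto_def\<close>)
  then have "openin top_X {x}" using openin_cylinder[of M x] by simp
  moreover have "periodic_point x"
    unfolding periodic_point_def shift_funpow
    using d periodic[OF x] by (intro exI[of _ d]) (auto simp: agree_upto_def)
  ultimately show False using no_isolated x by (auto simp: no_isolated_periodic_points_def)
qed

text \<open>The source of the symmetry of the walk on an orbit: both sides, as functions of \<open>x\<close>, undo the
  displacement of \<open>g\<close>, so uniqueness applies.\<close>

lemma cocycle_inverse:
  assumes g: "g \<in> carrier \<G>" and x: "x \<in> X"
  shows "cocycle (inv\<^bsub>\<G>\<^esub> g) (g x) = - cocycle g x"
proof -
  let ?g' = "inv\<^bsub>\<G>\<^esub> g"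
  have g': "?g' \<in> carrier \<G>" using g by simp
  have "continuous_cocycle (cocycle ?g' \<circ> g)"
    using g cocycle(1)[OF g'] unfolding full_group_iff
    by (blast intro: homeomorphic_imp_continuous_map continuous_map_compose)
  then have c1: "continuous_cocycle (\<lambda>x. cocycle ?g' (g x))" by (simp add: o_def)
  have "continuous_cocycle (uminus \<circ> cocycle g)"
    by (rule continuous_map_compose[OF cocycle(1)[OF g]]) simp
  then have c2: "continuous_cocycle (\<lambda>x. - cocycle g x)" by (simp add: o_def)
  show ?thesis
  proof (rule cocycle_unique[OF c1 c2 _ x])
    fix y assume y: "y \<in> X"
    have cancel: "?g' (g y) = y"
      using full_group_mult[OF g' g y] g y by (simp add: full_group.l_inv)
    then have 1: "shift_pow (cocycle ?g' (g y)) (g y) = y"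
      using cocycle(2)[OF g' full_group_mem[OF g y]] by simp
    have gy: "g y = shift_pow (cocycle g y) y" by (rule cocycle(2)[OF g y])
    have 2: "shift_pow (- cocycle g y) (g y) = y" unfolding gy by (simp flip: shift_pow_add)
    have "shift_pow (cocycle ?g' (g y)) y = shift_pow (cocycle ?g' (g y)) (shift_pow (- cocycle g y) (g y))"
      using 2 by simp
    also have "\<dots> = shift_pow (- cocycle g y) (shift_pow (cocycle ?g' (g y)) (g y))"
      by (simp flip: shift_pow_add add: add.commute)
    finally show "shift_pow (cocycle ?g' (g y)) y = shift_pow (- cocycle g y) y" using 1 by simp
  qed
qed

end

section \<open>Walks along orbits\<close>

lemma (in subshift_space) finite_words: "finite (subshift_words X n)"
proof (rule finite_subset)
  show "subshift_words X n \<subseteq> {xs. set xs \<subseteq> A \<and> length xs = n}"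
    using X_in_alphabet by (auto simp: subshift_words_def)
  show "finite {xs. set xs \<subseteq> A \<and> length xs = n}"
    by (rule finite_lists_length_eq[OF finite_alphabet])
qed

lemma (in subshift_space) complexity_mono:
  assumes "m \<le> n"
  shows "complexity X m \<le> complexity X n"
proof -
  have "subshift_words X m \<subseteq> take m ` subshift_words X n"
  proof
    fix u assume "u \<in> subshift_words X m"
    then obtain x i where x: "x \<in> X" "u = map (\<lambda>j. x (i + int j)) [0..<m]"
      by (auto simp: subshift_words_def)
    have "u = take m (map (\<lambda>j. x (i + int j)) [0..<n])"
      using assms x(2) by (simp add: take_map)
    then show "u \<in> take m ` subshift_words X n"
      using x(1) by (auto simp: subshift_words_def)
  qed
  then show ?thesis
    unfolding complexity_def using finite_words by (rule surj_card_le[rotated])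
qed

definition central_word :: "nat \<Rightarrow> (int \<Rightarrow> 'a) \<Rightarrow> 'a list" where
  "central_word m x = map (\<lambda>j. x (- int m + int j)) [0..<2 * m + 1]"

lemma central_word_in_words: "x \<in> X \<Longrightarrow> central_word m x \<in> subshift_words X (2 * m + 1)"
  unfolding central_word_def subshift_words_def by blast

lemma central_word_eq_iff: "central_word m x = central_word m y \<longleftrightarrow> agree_upto m x y"
proof
  assume eq: "central_word m x = central_word m y"
  show "agree_upto m x y"
    unfolding agree_upto_def
  proof (intro allI impI)
    fix i assume i: "\<bar>i\<bar> \<le> int m"
    have i0: "0 \<le> i + int m" using i by linarith
    have "nat (i + int m) < 2 * m + 1" using i by linarith
    moreover from this have "central_word m x ! nat (i + int m) = x i" "central_word m y ! nat (i + int m) = y i"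
      using i0 by (simp_all add: central_word_def del: upt_Suc)
    ultimately show "x i = y i" using eq by simp
  qed
next
  assume "agree_upto m x y"
  then show "central_word m x = central_word m y"
    unfolding central_word_def agree_upto_def by (intro map_cong refl) auto
qed

primrec (in subshift_space) position ::
    "(int \<Rightarrow> 'a) \<Rightarrow> ((int \<Rightarrow> 'a) \<Rightarrow> (int \<Rightarrow> 'a)) list \<Rightarrow> int" where
  "position x [] = 0"
| "position x (s # w) = position x w + cocycle s (shift_pow (position x w) x)"

text \<open>Some suffix of the list, that is, some intermediate time of the walk, has carried \<open>x\<close> further
  than \<open>R\<close>.\<close>

primrec (in subshift_space) exceeds ::
    "nat \<Rightarrow> (int \<Rightarrow> 'a) \<Rightarrow> ((int \<Rightarrow> 'a) \<Rightarrow> (int \<Rightarrow> 'a)) list \<Rightarrow> bool" where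
  "exceeds R x [] \<longleftrightarrow> False"
| "exceeds R x (s # w) \<longleftrightarrow> exceeds R x w \<or> \<bar>position x (s # w)\<bar> > int R"

context subshift_space
begin

lemma foldr_in_full_group:
  "set w \<subseteq> carrier \<G> \<Longrightarrow> foldr (\<otimes>\<^bsub>\<G>\<^esub>) w \<one>\<^bsub>\<G>\<^esub> \<in> carrier \<G>"
  by (induction w) auto

lemma product_eq_shift_position:
  assumes "x \<in> X" "set w \<subseteq> carrier \<G>"
  shows "foldr (\<otimes>\<^bsub>\<G>\<^esub>) w \<one>\<^bsub>\<G>\<^esub> x = shift_pow (position x w) x"
  using assms(2)
proof (induction w)
  case Nil then show ?case using assms(1) by simp
next
  case (Cons s w)
  then have s: "s \<in> carrier \<G>" and w: "foldr (\<otimes>\<^bsub>\<G>\<^esub>) w \<one>\<^bsub>\<G>\<^esub> \<in> carrier \<G>"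
    using foldr_in_full_group by auto
  have "foldr (\<otimes>\<^bsub>\<G>\<^esub>) (s # w) \<one>\<^bsub>\<G>\<^esub> x = s (shift_pow (position x w) x)"
    using full_group_mult[OF s w assms(1)] Cons by simp
  also have "\<dots> = shift_pow (cocycle s (shift_pow (position x w) x)) (shift_pow (position x w) x)"
    by (rule cocycle(2)[OF s shift_invariant[OF assms(1)]])
  finally show ?case by (simp add: add.commute flip: shift_pow_add)
qed

lemma not_exceeds_position: "\<not> exceeds R x w \<Longrightarrow> \<bar>position x w\<bar> \<le> int R"
  by (cases w) auto

text \<open>While a walk stays within \<open>R\<close>, its steps look only at coordinates within \<open>R + K\<close>.\<close>

lemma position_local:
  assumes xy: "x \<in> X" "y \<in> X" "agree_upto (R + K) x y"
    and loc: "\<And>s. s \<in> set w \<Longrightarrow> local_on X K (cocycle s)" and ne: "\<not> exceeds R x w"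
  shows "position x w = position y w"
  using loc ne
proof (induction w)
  case (Cons s w)
  then have ne: "\<not> exceeds R x w" and IH: "position x w = position y w" by auto
  have le: "\<bar>position x w\<bar> \<le> int R" by (rule not_exceeds_position[OF ne])
  have "agree_upto K (shift_pow (position x w) x) (shift_pow (position x w) y)"
    using agree_upto_shift_pow[of K R x y] xy(3) le by (simp add: add.commute)
  moreover have "local_on X K (cocycle s)" using Cons.prems by simp
  ultimately have "cocycle s (shift_pow (position x w) x) = cocycle s (shift_pow (position x w) y)"
    using shift_invariant xy unfolding local_on_def by blast
  then show ?case using IH by simp
qed simp

lemma position_le:
  assumes "x \<in> X" "\<And>s y. s \<in> set w \<Longrightarrow> y \<in> X \<Longrightarrow> \<bar>cocycle s y\<bar> \<le> int K"
  shows "\<bar>position x w\<bar> \<le> int (length w) * int K"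
  using assms(2)
proof (induction w)
  case (Cons s w)
  have "\<bar>cocycle s (shift_pow (position x w) x)\<bar> \<le> int K"
    using Cons.prems shift_invariant[OF assms(1)] by simp
  moreover have "\<bar>position x w\<bar> \<le> int (length w) * int K" using Cons by simp
  ultimately show ?case by (simp add: algebra_simps)
qed simp

lemma exceeds_mono: "exceeds R x w \<Longrightarrow> R' \<le> R \<Longrightarrow> exceeds R' x w"
  by (induction w) auto

lemma not_exceeds_length:
  assumes "x \<in> X" "\<And>s y. s \<in> set w \<Longrightarrow> y \<in> X \<Longrightarrow> \<bar>cocycle s y\<bar> \<le> int K"
  shows "\<not> exceeds (length w * K) x w"
  using assms(2)
proof (induction w)
  case (Cons s w)
  have "\<not> exceeds (length w * K) x w" using Cons by simp
  then have "\<not> exceeds (length (s # w) * K) x w" using exceeds_mono[of "length (s # w) * K" x w "length w * K"] by auto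
  moreover have "\<bar>position x (s # w)\<bar> \<le> int (length (s # w) * K)"
    using position_le[OF assms(1), of "s # w" K] Cons.prems by (simp add: algebra_simps)
  ultimately show ?case by simp
qed simp

text \<open>Over the full duration of the walk only a window of linear size is visible, since \<open>n\<close> steps reach
  no further than \<open>n K\<close>.\<close>

lemma exceeds_local:
  assumes xy: "x \<in> X" "y \<in> X" "agree_upto (length w * K + K) x y"
    and loc: "\<And>s. s \<in> set w \<Longrightarrow> local_on X K (cocycle s)"
    and bd: "\<And>s z. s \<in> set w \<Longrightarrow> z \<in> X \<Longrightarrow> \<bar>cocycle s z\<bar> \<le> int K"
  shows "exceeds R x w \<longleftrightarrow> exceeds R y w"
  using xy(3) loc bd
proof (induction w)
  case (Cons s w)
  have "agree_upto (length w * K + K) x y" using Cons.prems(1) by (rule agree_upto_mono) simp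
  then have "exceeds R x w = exceeds R y w" using Cons by simp
  moreover have "position x (s # w) = position y (s # w)"
    by (rule position_local[OF xy(1,2) Cons.prems(1)])
      (use Cons.prems not_exceeds_length[OF xy(1), of "s # w" K] in auto)
  ultimately show ?case by simp
qed simp

end

locale full_group_walk = nonisolated_subshift A X for A :: "'a set" and X :: "(int \<Rightarrow> 'a) set" +
  fixes \<mu> :: "((int \<Rightarrow> 'a) \<Rightarrow> (int \<Rightarrow> 'a)) pmf" and K :: nat
  assumes support: "set_pmf \<mu> \<subseteq> carrier \<G>" and finite_support: "finite (set_pmf \<mu>)"
    and symmetric: "symmetric_pmf \<G> \<mu>"
    and K_pos: "K \<ge> 1"
    and local_cocycle: "s \<in> set_pmf \<mu> \<Longrightarrow> local_on X K (cocycle s)"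
    and bounded_cocycle: "s \<in> set_pmf \<mu> \<Longrightarrow> x \<in> X \<Longrightarrow> \<bar>cocycle s x\<bar> \<le> int K"
begin

definition step :: "(int \<Rightarrow> 'a) \<Rightarrow> ((int \<Rightarrow> 'a) \<Rightarrow> (int \<Rightarrow> 'a)) \<Rightarrow> int \<Rightarrow> int" where
  "step x s i = i + cocycle s (shift_pow i x)"

definition kernel :: "(int \<Rightarrow> 'a) \<Rightarrow> int \<Rightarrow> int \<Rightarrow> real" where
  "kernel x i j = (\<Sum>s\<in>set_pmf \<mu>. if step x s i = j then pmf \<mu> s else 0)"

lemma step_inverse:
  assumes x: "x \<in> X" and s: "s \<in> carrier \<G>"
  shows "step x (inv\<^bsub>\<G>\<^esub> s) (step x s i) = i"
proof -
  have y: "shift_pow i x \<in> X" by (rule shift_invariant[OF x])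
  have "shift_pow (step x s i) x = s (shift_pow i x)"
    unfolding cocycle(2)[OF s y] step_def by (simp add: add.commute flip: shift_pow_add)
  then show ?thesis
    using cocycle_inverse[OF s y] by (simp add: step_def)
qed

lemma inv_in_support: "s \<in> set_pmf \<mu> \<Longrightarrow> inv\<^bsub>\<G>\<^esub> s \<in> set_pmf \<mu>"
  using symmetric support unfolding symmetric_pmf_def set_pmf_iff by (metis (no_types, lifting) set_pmf_iff subsetD)

text \<open>Replacing each letter by its inverse reverses the transition.\<close>

lemma kernel_symmetric:
  assumes x: "x \<in> X"
  shows "kernel x i j = kernel x j i"
  unfolding kernel_def
proof (rule sum.reindex_bij_witness[of _ "\<lambda>s. inv\<^bsub>\<G>\<^esub> s" "\<lambda>s. inv\<^bsub>\<G>\<^esub> s"])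
  fix s assume s: "s \<in> set_pmf \<mu>"
  then have sc: "s \<in> carrier \<G>" using support by auto
  then show "inv\<^bsub>\<G>\<^esub> (inv\<^bsub>\<G>\<^esub> s) = s" by simp
  then show "inv\<^bsub>\<G>\<^esub> (inv\<^bsub>\<G>\<^esub> s) = s" .
  show "inv\<^bsub>\<G>\<^esub> s \<in> set_pmf \<mu>" by (rule inv_in_support[OF s])
  then show "inv\<^bsub>\<G>\<^esub> s \<in> set_pmf \<mu>" .
  have "step x (inv\<^bsub>\<G>\<^esub> s) j = i \<longleftrightarrow> step x s i = j"
    using step_inverse[OF x sc, of i] step_inverse[OF x full_group.inv_closed[OF sc], of j] sc by auto
  moreover have "pmf \<mu> (inv\<^bsub>\<G>\<^esub> s) = pmf \<mu> s"
    using symmetric sc unfolding symmetric_pmf_def by metis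
  ultimately show "(if step x (inv\<^bsub>\<G>\<^esub> s) j = i then pmf \<mu> (inv\<^bsub>\<G>\<^esub> s) else 0)
      = (if step x s i = j then pmf \<mu> s else 0)" by simp
qed

lemma kernel_locale:
  assumes x: "x \<in> X" and B: "finite B" "0 \<in> B"
  shows "symmetric_range_kernel B (kernel x) K"
proof
  show "finite B" by (rule B(1))
  show "0 \<le> kernel x i j" for i j unfolding kernel_def by (intro sum_nonneg) simp
  show "kernel x i j = kernel x j i" for i j by (rule kernel_symmetric[OF x])
  show "(\<Sum>j\<in>B. kernel x i j) \<le> 1" for i
  proof -
    have "(\<Sum>j\<in>B. kernel x i j) = (\<Sum>s\<in>set_pmf \<mu>. \<Sum>j\<in>B. if step x s i = j then pmf \<mu> s else 0)"
      unfolding kernel_def by (rule sum.swap)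
    also have "\<dots> \<le> (\<Sum>s\<in>set_pmf \<mu>. pmf \<mu> s)"
      by (intro sum_mono) (simp add: sum.delta' B(1))
    also have "\<dots> = 1" by (rule sum_pmf_eq_1[OF finite_support order_refl])
    finally show ?thesis .
  qed
  show "\<bar>i - j\<bar> \<le> int K" if "kernel x i j \<noteq> 0" for i j
  proof -
    have "\<exists>s\<in>set_pmf \<mu>. step x s i = j"
    proof (rule ccontr)
      assume "\<not> ?thesis"
      then have "kernel x i j = 0" unfolding kernel_def by (intro sum.neutral) auto
      then show False using that by simp
    qed
    then obtain s where "s \<in> set_pmf \<mu>" "step x s i = j" by blast
    then show ?thesis using bounded_cocycle[OF _ shift_invariant[OF x], of s i] by (auto simp: step_def)
  qed
  show "0 \<in> B" by (rule B(2))
qed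

definition law :: "(int \<Rightarrow> 'a) \<Rightarrow> nat \<Rightarrow> int pmf" where
  "law x n = map_pmf (position x) (replicate_pmf n \<mu>)"

lemma law_Suc: "law x (Suc n) = bind_pmf (law x n) (\<lambda>i. map_pmf (\<lambda>s. step x s i) \<mu>)"
proof -
  have "law x (Suc n) = bind_pmf \<mu> (\<lambda>s. bind_pmf (replicate_pmf n \<mu>) (\<lambda>w. return_pmf (step x s (position x w))))"
    by (simp add: law_def map_bind_pmf step_def)
  also have "\<dots> = bind_pmf (replicate_pmf n \<mu>) (\<lambda>w. bind_pmf \<mu> (\<lambda>s. return_pmf (step x s (position x w))))"
    by (rule bind_commute_pmf)
  finally show ?thesis by (simp add: law_def map_pmf_def bind_assoc_pmf bind_return_pmf)
qed

lemma set_law: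
  assumes "x \<in> X" "n \<le> m"
  shows "set_pmf (law x n) \<subseteq> {- int (m * K)..int (m * K)}"
proof
  fix j assume "j \<in> set_pmf (law x n)"
  then obtain w where w: "set w \<subseteq> set_pmf \<mu>" "length w = n" "j = position x w"
    by (auto simp: law_def set_replicate_pmf)
  have "\<bar>j\<bar> \<le> int (length w) * int K" unfolding w(3)
    by (rule position_le[OF assms(1)]) (use w bounded_cocycle in auto)
  also have "\<dots> \<le> int (m * K)" using w assms by (simp add: mult_right_mono)
  finally show "j \<in> {- int (m * K)..int (m * K)}" by auto
qed

text \<open>Up to time \<open>m\<close> the walk cannot leave the interval of radius \<open>m K\<close>, so the powers of the kernel
  restricted to this finite interval describe it exactly.\<close>

lemma pmf_law:
  assumes x: "x \<in> X" and "n \<le> m"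
  shows "pmf (law x n) = (kernel_op {- int (m * K)..int (m * K)} (kernel x) ^^ n) (\<lambda>i. if i = 0 then 1 else 0)"
  using assms(2)
proof (induction n)
  case 0
  show ?case by (auto simp: law_def fun_eq_iff indicator_def)
next
  case (Suc n)
  let ?B = "{- int (m * K)..int (m * K)}"
  have k: "pmf (map_pmf (\<lambda>s. step x s i) \<mu>) j = kernel x j i" for i j
  proof -
    have "pmf (map_pmf (\<lambda>s. step x s i) \<mu>) j = measure \<mu> ({s. step x s i = j} \<inter> set_pmf \<mu>)"
      by (simp add: pmf_map vimage_def measure_Int_set_pmf)
    also have "\<dots> = (\<Sum>s\<in>{s. step x s i = j} \<inter> set_pmf \<mu>. pmf \<mu> s)"
      using finite_support by (intro measure_measure_pmf_finite) simp
    also have "\<dots> = kernel x i j"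
      unfolding kernel_def using finite_support by (simp add: sum.If_cases Int_commute)
    finally show ?thesis using kernel_symmetric[OF x] by simp
  qed
  show ?case
  proof
    fix j
    have "pmf (law x (Suc n)) j = (\<Sum>i\<in>?B. kernel x j i * pmf (law x n) i)"
      unfolding law_Suc pmf_bind k
      by (rule integral_measure_pmf_real) (use set_law[OF x, of n m] Suc.prems in auto)
    also have "\<dots> = kernel_op ?B (kernel x) (pmf (law x n)) j" by (simp only: kernel_op_def)
    finally show "pmf (law x (Suc n)) j = (kernel_op ?B (kernel x) ^^ Suc n) (\<lambda>i. if i = 0 then 1 else 0) j"
      using Suc by simp
  qed
qed

lemma position_tail:
  assumes x: "x \<in> X" and t: "t \<ge> 0" and n: "n \<le> N"
  shows "measure (replicate_pmf n \<mu>) {w. \<bar>position x w\<bar> > int R}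
    \<le> real (2 * N * K + 1) * (2 * real (N + 1) * exp (real N * t\<^sup>2 / 2 - t * real R / real K))"
proof -
  let ?B = "{- int (N * K)..int (N * K)}"
  let ?far = "{j. \<bar>j\<bar> > int R} :: int set"
  interpret symmetric_range_kernel ?B "kernel x" K
    by (rule kernel_locale[OF x]) auto
  have "measure (replicate_pmf n \<mu>) {w. \<bar>position x w\<bar> > int R} = measure (law x n) ?far"
    by (simp add: law_def vimage_def)
  also have "\<dots> = measure (law x n) (?far \<inter> set_pmf (law x n))"
    by (simp add: measure_Int_set_pmf)
  also have "\<dots> \<le> measure (law x n) (?far \<inter> ?B)"
    using set_law[OF x n] by (intro measure_pmf.finite_measure_mono) auto
  also have "\<dots> = (\<Sum>j\<in>?far \<inter> ?B. pmf (law x n) j)"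
    by (intro measure_measure_pmf_finite) simp
  also have "\<dots> \<le> (\<Sum>j\<in>?far \<inter> ?B. 2 * real (N + 1) * exp (real N * t\<^sup>2 / 2 - t * real R / real K))"
  proof (rule sum_mono)
    fix j assume j: "j \<in> ?far \<inter> ?B"
    have "pmf (law x n) j \<le> \<bar>(kernel_op ?B (kernel x) ^^ n) (\<lambda>i. if i = 0 then 1 else 0) j\<bar>"
      unfolding pmf_law[OF x n] by simp
    also have "\<dots> \<le> 2 * real (n + 1) * exp (real n * t\<^sup>2 / 2 - t * \<bar>j\<bar> / real K)"
      using carne_bound[of j t n] j K_pos t by simp
    also have "\<dots> \<le> 2 * real (N + 1) * exp (real N * t\<^sup>2 / 2 - t * real R / real K)"
    proof (intro mult_mono)
      have "t * real R / real K \<le> t * real_of_int \<bar>j\<bar> / real K"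
        using j t K_pos by (intro divide_right_mono mult_left_mono) auto
      moreover have "real n * t\<^sup>2 \<le> real N * t\<^sup>2" using n by (intro mult_right_mono) auto
      ultimately show "exp (real n * t\<^sup>2 / 2 - t * \<bar>j\<bar> / real K) \<le> exp (real N * t\<^sup>2 / 2 - t * real R / real K)" by simp
    qed (use n in auto)
    finally show "pmf (law x n) j \<le> 2 * real (N + 1) * exp (real N * t\<^sup>2 / 2 - t * real R / real K)" .
  qed
  also have "\<dots> = real (card (?far \<inter> ?B)) * (2 * real (N + 1) * exp (real N * t\<^sup>2 / 2 - t * real R / real K))"
    by simp
  also have "\<dots> \<le> real (2 * N * K + 1) * (2 * real (N + 1) * exp (real N * t\<^sup>2 / 2 - t * real R / real K))"
  proof (intro mult_right_mono)
    have "card (?far \<inter> ?B) \<le> card ?B" by (intro card_mono) auto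
    also have "\<dots> = nat (int (2 * N * K + 1))" unfolding card_atLeastAtMost_int by (simp add: mult_ac)
    also have "\<dots> = 2 * N * K + 1" by (rule nat_int)
    finally show "real (card (?far \<inter> ?B)) \<le> real (2 * N * K + 1)" by linarith
  qed auto
  finally show ?thesis .
qed

text \<open>Union bound over the intermediate times; dropping the last step of the walk, which is the head of
  the list, gives the walk of length \<open>n\<close>.\<close>

lemma exceeds_tail:
  assumes x: "x \<in> X" and t: "t \<ge> 0" and n: "n \<le> N"
  shows "measure (replicate_pmf n \<mu>) {w. exceeds R x w}
    \<le> real n * (real (2 * N * K + 1) * (2 * real (N + 1) * exp (real N * t\<^sup>2 / 2 - t * real R / real K)))"
  using n
proof (induction n)
  case 0
  show ?case by (simp add: indicator_def)
next
  case (Suc n)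
  let ?D = "real (2 * N * K + 1) * (2 * real (N + 1) * exp (real N * t\<^sup>2 / 2 - t * real R / real K))"
  have tl: "map_pmf tl (replicate_pmf (Suc n) \<mu>) = replicate_pmf n \<mu>"
    by (simp add: map_bind_pmf bind_return_pmf')
  have "exceeds R x w \<Longrightarrow> exceeds R x (tl w) \<or> \<bar>position x w\<bar> > int R" for w
    by (cases w) auto
  then have "measure (replicate_pmf (Suc n) \<mu>) {w. exceeds R x w}
      \<le> measure (replicate_pmf (Suc n) \<mu>) ({w. exceeds R x (tl w)} \<union> {w. \<bar>position x w\<bar> > int R})"
    by (intro measure_pmf.finite_measure_mono) auto
  also have "\<dots> \<le> measure (replicate_pmf (Suc n) \<mu>) {w. exceeds R x (tl w)}
      + measure (replicate_pmf (Suc n) \<mu>) {w. \<bar>position x w\<bar> > int R}"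
    by (rule measure_Un_le) auto
  also have "measure (replicate_pmf (Suc n) \<mu>) {w. exceeds R x (tl w)} = measure (replicate_pmf n \<mu>) {w. exceeds R x w}"
    unfolding tl[symmetric] measure_map_pmf vimage_def by simp
  also have "\<dots> \<le> real n * ?D" using Suc by simp
  also have "measure (replicate_pmf (Suc n) \<mu>) {w. \<bar>position x w\<bar> > int R} \<le> ?D"
    by (rule position_tail[OF x t Suc.prems])
  finally show ?case by (simp add: algebra_simps)
qed

text \<open>Union bound over the points of \<open>X\<close>, of which only the windows of radius \<open>n K + K\<close> matter.\<close>

lemma exceeds_somewhere_tail:
  assumes t: "t \<ge> 0"
  shows "measure (replicate_pmf n \<mu>) {w. \<exists>x\<in>X. exceeds R x w}
    \<le> real (complexity X (2 * (n * K + K) + 1)) *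
      (real n * (real (2 * n * K + 1) * (2 * real (n + 1) * exp (real n * t\<^sup>2 / 2 - t * real R / real K))))"
proof -
  let ?M = "n * K + K"
  let ?D = "real n * (real (2 * n * K + 1) * (2 * real (n + 1) * exp (real n * t\<^sup>2 / 2 - t * real R / real K)))"
  define U where "U = central_word ?M ` X"
  define r where "r u = (SOME x. x \<in> X \<and> central_word ?M x = u)" for u
  have r: "r u \<in> X" "central_word ?M (r u) = u" if "u \<in> U" for u
    using someI_ex[of "\<lambda>x. x \<in> X \<and> central_word ?M x = u"] that unfolding r_def U_def by auto
  have Usub: "U \<subseteq> subshift_words X (2 * ?M + 1)" unfolding U_def by (intro image_subsetI central_word_in_words)
  have Ufin: "finite U" using Usub finite_words finite_subset by blast
  have cU: "card U \<le> complexity X (2 * ?M + 1)"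
    unfolding complexity_def by (rule card_mono[OF finite_words Usub])
  have "measure (replicate_pmf n \<mu>) {w. \<exists>x\<in>X. exceeds R x w}
      = measure (replicate_pmf n \<mu>) ({w. \<exists>x\<in>X. exceeds R x w} \<inter> set_pmf (replicate_pmf n \<mu>))"
    by (simp add: measure_Int_set_pmf)
  also have "\<dots> \<le> measure (replicate_pmf n \<mu>) (\<Union>u\<in>U. {w. exceeds R (r u) w})"
  proof (intro measure_pmf.finite_measure_mono subsetI)
    fix w assume w: "w \<in> {w. \<exists>x\<in>X. exceeds R x w} \<inter> set_pmf (replicate_pmf n \<mu>)"
    then obtain x where x: "x \<in> X" "exceeds R x w" by blast
    have w': "set w \<subseteq> set_pmf \<mu>" "length w = n" using w by (auto simp: set_replicate_pmf)
    have u: "central_word ?M x \<in> U" using x by (simp add: U_def)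
    have "agree_upto (length w * K + K) x (r (central_word ?M x))"
      using r(2)[OF u] w'(2) central_word_eq_iff by metis
    then have "exceeds R x w = exceeds R (r (central_word ?M x)) w"
      by (intro exceeds_local[OF x(1) r(1)[OF u]]) (use w' local_cocycle bounded_cocycle in auto)
    then show "w \<in> (\<Union>u\<in>U. {w. exceeds R (r u) w})" using u x(2) by blast
  qed auto
  also have "\<dots> \<le> (\<Sum>u\<in>U. measure (replicate_pmf n \<mu>) {w. exceeds R (r u) w})"
    by (intro measure_pmf.finite_measure_subadditive_finite Ufin) auto
  also have "\<dots> \<le> (\<Sum>u\<in>U. ?D)"
    by (intro sum_mono exceeds_tail[OF r(1) t order_refl])
  also have "\<dots> = real (card U) * ?D" by simp
  also have "\<dots> \<le> real (complexity X (2 * ?M + 1)) * ?D"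
    using cU by (intro mult_right_mono) auto
  finally show ?thesis .
qed

text \<open>The maps on \<open>X\<close> that displace each point by at most \<open>R\<close>, the displacement being read off from the
  window of radius \<open>R + K\<close>. The set is finite and contains every product of steps under which no point
  ever moves further than \<open>R\<close>.\<close>

definition confined :: "nat \<Rightarrow> ((int \<Rightarrow> 'a) \<Rightarrow> (int \<Rightarrow> 'a)) set" where
  "confined R = (\<lambda>\<phi>. \<lambda>x\<in>X. shift_pow (\<phi> (central_word (R + K) x)) x) `
     (PiE (subshift_words X (2 * (R + K) + 1)) (\<lambda>_. {- int R..int R}))"

lemma finite_confined: "finite (confined R)"
  unfolding confined_def by (intro finite_imageI finite_PiE finite_words) auto

lemma card_confined: "card (confined R) \<le> (2 * R + 1) ^ complexity X (2 * (R + K) + 1)"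
proof -
  have "card (confined R) \<le> card (PiE (subshift_words X (2 * (R + K) + 1)) (\<lambda>_. {- int R..int R}))"
    unfolding confined_def by (intro card_image_le finite_PiE finite_words) auto
  also have "\<dots> = (2 * R + 1) ^ complexity X (2 * (R + K) + 1)"
  proof -
    have "card {- int R..int R} = nat (int (2 * R + 1))" unfolding card_atLeastAtMost_int by simp
    then have "card {- int R..int R} = 2 * R + 1" by (simp only: nat_int)
    then show ?thesis by (simp only: card_PiE[OF finite_words] complexity_def prod_constant)
  qed
  finally show ?thesis .
qed

text \<open>By \<open>position_local\<close> the final displacement is a function of the window of radius \<open>R + K\<close>, so it
  can be tabulated by choosing one point for each window.\<close>

lemma product_in_confined:
  assumes w: "set w \<subseteq> set_pmf \<mu>" and ne: "\<And>x. x \<in> X \<Longrightarrow> \<not> exceeds R x w"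
  shows "foldr (\<otimes>\<^bsub>\<G>\<^esub>) w \<one>\<^bsub>\<G>\<^esub> \<in> confined R"
proof -
  let ?g = "foldr (\<otimes>\<^bsub>\<G>\<^esub>) w \<one>\<^bsub>\<G>\<^esub>"
  have wc: "set w \<subseteq> carrier \<G>" using w support by auto
  define r where "r u = (SOME x. x \<in> X \<and> central_word (R + K) x = u)" for u
  define \<phi> where "\<phi> = (\<lambda>u\<in>subshift_words X (2 * (R + K) + 1).
    if u \<in> central_word (R + K) ` X then position (r u) w else 0)"
  have r: "r u \<in> X" "central_word (R + K) (r u) = u" if "u \<in> central_word (R + K) ` X" for u
    using someI_ex[of "\<lambda>x. x \<in> X \<and> central_word (R + K) x = u"] that unfolding r_def by auto
  have "\<phi> \<in> PiE (subshift_words X (2 * (R + K) + 1)) (\<lambda>_. {- int R..int R})"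
    unfolding \<phi>_def using not_exceeds_position[OF ne[OF r(1)]] by (force simp: abs_le_iff)
  moreover have "?g = (\<lambda>x\<in>X. shift_pow (\<phi> (central_word (R + K) x)) x)"
  proof
    fix x
    show "?g x = (\<lambda>x\<in>X. shift_pow (\<phi> (central_word (R + K) x)) x) x"
    proof (cases "x \<in> X")
      case False
      have "?g \<in> extensional X" using foldr_in_full_group[OF wc] by (simp add: full_group_iff Bij_def)
      then show ?thesis using False by (simp add: extensional_def)
    next
      case x: True
      let ?u = "central_word (R + K) x"
      have u: "?u \<in> central_word (R + K) ` X" using x by simp
      have "agree_upto (R + K) x (r ?u)" using r(2)[OF u] central_word_eq_iff by metis
      then have "position x w = position (r ?u) w"
        by (intro position_local[OF x r(1)[OF u]]) (use w local_cocycle ne x in auto)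
      moreover have "\<phi> ?u = position (r ?u) w" using u central_word_in_words[OF x, of "R + K"] unfolding \<phi>_def by (simp only: restrict_apply' if_True)
      ultimately show ?thesis using product_eq_shift_position[OF x wc] x by simp
    qed
  qed
  ultimately show ?thesis unfolding confined_def by (intro image_eqI)
qed

theorem return_probability_confined:
  assumes "measure (replicate_pmf n \<mu>) {w. \<exists>x\<in>X. exceeds R x w} \<le> 1 / 2"
  shows "1 / 4 \<le> real ((2 * R + 1) ^ complexity X (2 * (R + K) + 1))
    * pmf (convolution_power \<G> \<mu> (2 * n)) \<one>\<^bsub>\<G>\<^esub>"
proof -
  let ?E = "{w. \<exists>x\<in>X. exceeds R x w}"
  have "1 - 1 / 2 \<le> 1 - measure (replicate_pmf n \<mu>) ?E" using assms by simp
  also have "\<dots> = measure (replicate_pmf n \<mu>) (- ?E)"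
    using measure_pmf.prob_compl[of ?E "replicate_pmf n \<mu>"] by (simp add: Compl_eq_Diff_UNIV)
  also have "\<dots> = measure (replicate_pmf n \<mu>) (- ?E \<inter> set_pmf (replicate_pmf n \<mu>))"
    by (simp add: measure_Int_set_pmf)
  also have "\<dots> \<le> measure (replicate_pmf n \<mu>) ((\<lambda>w. foldr (\<otimes>\<^bsub>\<G>\<^esub>) w \<one>\<^bsub>\<G>\<^esub>) -` confined R)"
  proof (intro measure_pmf.finite_measure_mono subsetI vimageI2)
    fix w assume w: "w \<in> - ?E \<inter> set_pmf (replicate_pmf n \<mu>)"
    then have "set w \<subseteq> set_pmf \<mu>" by (auto simp: set_replicate_pmf)
    then show "foldr (\<otimes>\<^bsub>\<G>\<^esub>) w \<one>\<^bsub>\<G>\<^esub> \<in> confined R"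
      using w by (intro product_in_confined) auto
  qed simp
  also have "\<dots> = measure (convolution_power \<G> \<mu> n) (confined R)"
    by (simp add: full_group.convolution_power_replicate[OF support])
  finally have "(1 / 2)\<^sup>2 \<le> (measure (convolution_power \<G> \<mu> n) (confined R))\<^sup>2"
    by (intro power_mono) auto
  also have "\<dots> \<le> real (card (confined R)) * pmf (convolution_power \<G> \<mu> (2 * n)) \<one>\<^bsub>\<G>\<^esub>"
    by (rule full_group.return_probability_ge[OF support finite_support symmetric finite_confined])
  also have "\<dots> \<le> real ((2 * R + 1) ^ complexity X (2 * (R + K) + 1)) * pmf (convolution_power \<G> \<mu> (2 * n)) \<one>\<^bsub>\<G>\<^esub>"
    using card_confined by (intro mult_right_mono) (simp_all only: of_nat_le_iff pmf_nonneg)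
  finally show ?thesis by (simp add: power2_eq_square)
qed

end

section \<open>Lower bound for the return probability\<close>

lemma (in nonisolated_subshift) walk_exists:
  assumes "set_pmf \<mu> \<subseteq> carrier \<G>" "finite (set_pmf \<mu>)" "symmetric_pmf \<G> \<mu>"
  shows "\<exists>K. full_group_walk A X \<mu> K"
proof -
  have "\<exists>m. local_on X m (cocycle s) \<and> (\<forall>x\<in>X. \<bar>cocycle s x\<bar> \<le> int m)" if "s \<in> set_pmf \<mu>" for s
  proof -
    have c: "continuous_cocycle (cocycle s)" using cocycle(1) that assms(1) by blast
    obtain a where a: "local_on X a (cocycle s)" using c continuous_cocycle_iff_local by blast
    obtain b :: nat where b: "\<forall>x\<in>X. \<bar>cocycle s x\<bar> \<le> int b" using continuous_cocycle_bounded[OF c] by blast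
    have "local_on X (max a b) (cocycle s)"
      using a agree_upto_mono[of "max a b" _ _ a] unfolding local_on_def by auto
    moreover have "\<forall>x\<in>X. \<bar>cocycle s x\<bar> \<le> int (max a b)" using b by fastforce
    ultimately show ?thesis by blast
  qed
  then have "\<forall>s\<in>set_pmf \<mu>. \<exists>m. local_on X m (cocycle s) \<and> (\<forall>x\<in>X. \<bar>cocycle s x\<bar> \<le> int m)" ..
  from bchoice[OF this] obtain m where
    m: "\<forall>s\<in>set_pmf \<mu>. local_on X (m s) (cocycle s) \<and> (\<forall>x\<in>X. \<bar>cocycle s x\<bar> \<le> int (m s))" ..
  define K where "K = 1 + (\<Sum>s\<in>set_pmf \<mu>. m s)"
  have K: "m s \<le> K" if "s \<in> set_pmf \<mu>" for s
    using member_le_sum[of s "set_pmf \<mu>" m] that assms(2) by (simp add: K_def)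
  have "full_group_walk A X \<mu> K"
  proof
    show "local_on X K (cocycle s)" if "s \<in> set_pmf \<mu>" for s
      using m that agree_upto_mono[OF _ K[OF that]] unfolding local_on_def by blast
    show "\<bar>cocycle s x\<bar> \<le> int K" if "s \<in> set_pmf \<mu>" "x \<in> X" for s x
    proof -
      have "\<bar>cocycle s x\<bar> \<le> int (m s)" using m that by blast
      then show ?thesis using K[OF that(1)] by linarith
    qed
  qed (use assms in \<open>auto simp: K_def\<close>)
  then show ?thesis ..
qed

lemma eventually_complexity_le_square:
  assumes "(\<lambda>n. (ln (real n) / real n)\<^sup>2 * real (complexity X n)) \<longlonglongrightarrow> 0"
  shows "\<exists>N. \<forall>n\<ge>N. complexity X n \<le> n\<^sup>2"
proof -
  have "\<forall>\<^sub>F n in sequentially. (ln (real n) / real n)\<^sup>2 * real (complexity X n) < 1"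
    using order_tendstoD(2)[OF assms, of 1] by simp
  then obtain N where N: "\<And>n. n \<ge> N \<Longrightarrow> (ln (real n) / real n)\<^sup>2 * real (complexity X n) < 1"
    by (auto simp: eventually_sequentially)
  have "complexity X n \<le> n\<^sup>2" if n: "n \<ge> max N 3" for n
  proof -
    have "1 \<le> ln (real n)" using n exp_le by (subst ln_ge_iff) (auto intro: order_trans)
    then have "real (complexity X n) \<le> (ln (real n))\<^sup>2 * real (complexity X n)"
      using mult_right_mono[of 1 "(ln (real n))\<^sup>2" "real (complexity X n)"] by simp
    also have "\<dots> = (real n)\<^sup>2 * ((ln (real n) / real n)\<^sup>2 * real (complexity X n))"
      using n by (simp add: power_divide)
    also have "\<dots> \<le> (real n)\<^sup>2 * 1" using N[of n] n by (intro mult_left_mono) auto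
    finally show ?thesis by (metis mult.right_neutral of_nat_le_iff of_nat_power)
  qed
  then show ?thesis by blast
qed

context full_group_walk
begin

text \<open>With \<open>t = R / (K n)\<close> the exponential factor is at most \<open>n powr -8\<close>. The factors in front of it are
  of order \<open>n\<^sup>2\<close> for the number of windows, \<open>n\<close> for the times, \<open>n\<close> for the end points and \<open>n\<close> from
  the Carne bound, altogether \<open>n\<^sup>5\<close>.\<close>

lemma confinement_probability:
  assumes N: "\<And>m. m \<ge> N \<Longrightarrow> complexity X m \<le> m\<^sup>2"
    and n: "n \<ge> 3" "n \<ge> N" "n \<ge> 600 * K ^ 3"
    and R: "R = nat \<lceil>4 * real K * sqrt (real n * ln (real n))\<rceil>"
  shows "measure (replicate_pmf n \<mu>) {w. \<exists>x\<in>X. exceeds R x w} \<le> 1 / 2"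
proof -
  define t where "t = real R / (real K * real n)"
  have n0: "real n > 0" "ln (real n) \<ge> 0" using n by auto
  have K0: "real K \<ge> 1" using K_pos by simp
  have "4 * real K * sqrt (real n * ln (real n)) \<le> real R" unfolding R by (rule real_nat_ceiling_ge)
  then have "(4 * real K * sqrt (real n * ln (real n)))\<^sup>2 \<le> (real R)\<^sup>2"
    using n0 by (intro power_mono) auto
  then have R2: "16 * (real K)\<^sup>2 * (real n * ln (real n)) \<le> (real R)\<^sup>2"
    using n0 by (simp add: power_mult_distrib)
  have "real n * t\<^sup>2 / 2 - t * real R / real K = - ((real R)\<^sup>2 / (2 * (real K)\<^sup>2 * real n))"
    using n0 K0 by (simp add: t_def power2_eq_square field_simps)
  also have "\<dots> \<le> - 8 * ln (real n)"
    using R2 n0 K0 by (simp add: field_simps)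
  finally have "exp (real n * t\<^sup>2 / 2 - t * real R / real K) \<le> exp (- 8 * ln (real n))" by simp
  also have "\<dots> = 1 / real n ^ 8"
    using n0 exp_of_nat_mult[of 8 "ln (real n)"] by (simp add: exp_minus field_simps)
  finally have e: "exp (real n * t\<^sup>2 / 2 - t * real R / real K) \<le> 1 / real n ^ 8" .
  have K1: "real K \<le> real n * real K" "1 \<le> real n * real K"
    using K0 n mult_mono[of 1 "real n" "real K" "real K"] mult_mono[of 1 "real n" 1 "real K"] by auto
  have "n \<le> n * K" using K_pos by simp
  also have "\<dots> \<le> 2 * (n * K + K) + 1" by simp
  finally have "complexity X (2 * (n * K + K) + 1) \<le> (2 * (n * K + K) + 1)\<^sup>2"
    using n(2) by (intro N) (rule order_trans)
  then have "real (complexity X (2 * (n * K + K) + 1)) \<le> real ((2 * (n * K + K) + 1)\<^sup>2)"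
    by (simp only: of_nat_le_iff)
  also have "\<dots> = (2 * (real n * real K + real K) + 1)\<^sup>2" by simp
  also have "\<dots> \<le> (5 * (real n * real K))\<^sup>2"
  proof (rule power_mono)
    have "2 * (q + real K) + 1 \<le> 5 * q" if "real K \<le> q" "1 \<le> q" for q :: real
      using that by simp
    from this[OF K1] show "2 * (real n * real K + real K) + 1 \<le> 5 * (real n * real K)" .
  qed (use K0 in simp)
  finally have c: "real (complexity X (2 * (n * K + K) + 1)) \<le> (5 * (real n * real K))\<^sup>2" .
  have "measure (replicate_pmf n \<mu>) {w. \<exists>x\<in>X. exceeds R x w}
    \<le> real (complexity X (2 * (n * K + K) + 1)) *
      (real n * (real (2 * n * K + 1) * (2 * real (n + 1) * exp (real n * t\<^sup>2 / 2 - t * real R / real K))))"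
    by (rule exceeds_somewhere_tail) (use n0 K0 in \<open>simp add: t_def\<close>)
  also have "\<dots> \<le> (5 * (real n * real K))\<^sup>2 * (real n * (3 * (real n * real K) * (4 * real n * (1 / real n ^ 8))))"
  proof -
    have X1: "real (2 * n * K + 1) \<le> 3 * (real n * real K)"
    proof -
      have "real (2 * n * K + 1) = 2 * (real n * real K) + 1" by simp
      then show ?thesis using K1(2) by linarith
    qed
    have X2: "2 * real (n + 1) \<le> 4 * real n" using n by simp
    show ?thesis
      by (intro mult_mono[OF c] mult_left_mono mult_mono[OF X1] mult_mono[OF X2 e]) simp_all
  qed
  also have "\<dots> = 300 * real K ^ 3 / real n ^ 3"
    using n0 by (simp add: field_simps power2_eq_square power3_eq_cube power_numeral_reduce)
  also have "\<dots> \<le> (real n / 2) / real n ^ 3"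
  proof (intro divide_right_mono)
    have "real (600 * K ^ 3) \<le> real n" using n(3) by (simp only: of_nat_le_iff)
    then show "300 * real K ^ 3 \<le> real n / 2" by simp
  qed simp
  also have "\<dots> \<le> 1 / 2"
  proof -
    have "1 \<le> (real n)\<^sup>2" using n by simp
    then show ?thesis using n0 by (simp add: field_simps power3_eq_cube power2_eq_square)
  qed
  finally show ?thesis .
qed

theorem return_probability_lower_bound:
  assumes lim: "(\<lambda>n. (ln (real n) / real n)\<^sup>2 * real (complexity X n)) \<longlonglongrightarrow> 0"
  shows "\<exists>C1 > 0. \<forall>n \<ge> 1. pmf (convolution_power \<G> \<mu> (2 * n)) \<one>\<^bsub>\<G>\<^esub>
    \<ge> 1 / C1 * exp (- C1 * real (complexity X (nat \<lceil>C1 * sqrt (real n * ln (real n))\<rceil>)) * ln (real n))"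
proof -
  define p where "p n = pmf (convolution_power \<G> \<mu> (2 * n)) \<one>\<^bsub>\<G>\<^esub>" for n
  have p_pos: "p n > 0" for n
    unfolding p_def by (rule full_group.return_probability_pos[OF support finite_support symmetric])
  obtain N where N: "\<And>m. m \<ge> N \<Longrightarrow> complexity X m \<le> m\<^sup>2"
    using eventually_complexity_le_square[OF lim] by blast
  define n0 where "n0 = max (max 3 N) (max (600 * K ^ 3) (11 * K))"
  \<comment> \<open>The first summand handles large \<open>n\<close>; the second one makes \<open>1 / C1\<close> a lower bound for the
    finitely many remaining values.\<close>
  define C1 where "C1 = 13 * real K + (\<Sum>n<n0. 1 / p n)"
  have sum0: "0 \<le> (\<Sum>n<n0. 1 / p n)" using p_pos by (intro sum_nonneg) (simp add: less_imp_le)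
  have K0: "real K \<ge> 1" using K_pos by simp
  have C1: "C1 \<ge> 13 * real K" "C1 > 0" using sum0 K0 by (auto simp: C1_def)
  have "p n \<ge> 1 / C1 * exp (- C1 * real (complexity X (nat \<lceil>C1 * sqrt (real n * ln (real n))\<rceil>)) * ln (real n))"
    if n: "n \<ge> 1" for n
  proof (cases "n < n0")
    case True
    have "1 / p n \<le> (\<Sum>n<n0. 1 / p n)"
      using True p_pos by (intro member_le_sum) (auto simp: less_imp_le)
    then have "1 / p n \<le> C1" using K0 by (simp add: C1_def)
    then have "1 / C1 \<le> p n" using p_pos[of n] C1(2) by (simp add: field_simps)
    moreover have "exp (- C1 * real (complexity X (nat \<lceil>C1 * sqrt (real n * ln (real n))\<rceil>)) * ln (real n)) \<le> 1"
      using C1(2) n by simp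
    ultimately show ?thesis
      using C1(2) by (intro order_trans[OF mult_left_le]) auto
  next
    case False
    then have n: "n \<ge> 3" "n \<ge> N" "n \<ge> 600 * K ^ 3" "n \<ge> 11 * K" by (auto simp: n0_def)
    define s where "s = sqrt (real n * ln (real n))"
    define R where "R = nat \<lceil>4 * real K * s\<rceil>"
    have ln1: "1 \<le> ln (real n)" using n exp_le by (subst ln_ge_iff) (auto intro: order_trans)
    have nln: "1 \<le> real n * ln (real n)"
      using mult_mono[of 1 "real n" 1 "ln (real n)"] ln1 n by simp
    then have s1: "1 \<le> s" by (simp add: s_def)
    have "real n * ln (real n) \<le> real n * real n"
      using n ln_le_minus_one[of "real n"] by (intro mult_left_mono) auto
    then have "s \<le> sqrt (real n * real n)" unfolding s_def by (rule real_sqrt_le_mono)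
    then have sn: "s \<le> real n" by simp
    have Rle: "real R \<le> 4 * real K * s + 1"
      unfolding R_def using s1 K0 by (simp add: of_nat_ceiling le_of_int_ceiling)
    have Ks: "1 \<le> real K * s" "real K \<le> real K * s"
      using mult_mono[of 1 "real K" 1 s] mult_left_mono[of 1 s "real K"] s1 K0 by auto
    have Kn: "real K * s \<le> real K * real n" using sn K0 by (intro mult_left_mono) auto
    have "real (11 * K) \<le> real n" using n(4) by (simp only: of_nat_le_iff)
    then have Kn2: "11 * real K * real n \<le> real n * real n" by (intro mult_right_mono) auto
    have R1: "real (2 * R + 1) \<le> real n ^ 2"
      using Rle Ks Kn Kn2 by (simp add: power2_eq_square)
    define L where "L = 2 * (R + K) + 1"
    define L1 where "L1 = nat \<lceil>C1 * s\<rceil>"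
    have "real L \<le> 13 * real K * s" unfolding L_def using Rle Ks by simp
    also have "\<dots> \<le> C1 * s" using C1(1) s1 by (intro mult_right_mono) auto
    also have "\<dots> \<le> real L1" unfolding L1_def by (rule real_nat_ceiling_ge)
    finally have "L \<le> L1" by (simp only: of_nat_le_iff)
    then have LL: "complexity X L \<le> complexity X L1" by (rule complexity_mono)
    have "1 / 4 \<le> real ((2 * R + 1) ^ complexity X L) * p n"
      unfolding L_def p_def
      by (rule return_probability_confined, rule confinement_probability[of N n R, OF N])
        (use n in \<open>auto simp: R_def s_def\<close>)
    also have "\<dots> \<le> (real n ^ 2) ^ complexity X L * p n"
      unfolding of_nat_power using R1 p_pos[of n] by (intro mult_right_mono power_mono) auto
    also have "(real n ^ 2) ^ complexity X L = exp (real (2 * complexity X L) * ln (real n))"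
      using n by (subst exp_of_nat_mult) (simp add: power_mult)
    finally have "1 / 4 * exp (- (real (2 * complexity X L) * ln (real n))) \<le> p n"
      unfolding exp_minus by (simp add: field_simps)
    moreover have "1 / C1 * exp (- C1 * real (complexity X L1) * ln (real n))
        \<le> 1 / 4 * exp (- (real (2 * complexity X L) * ln (real n)))"
    proof (intro mult_mono)
      show "1 / C1 \<le> 1 / 4" using C1 K0 by (simp add: field_simps)
      have "real (2 * complexity X L) \<le> C1 * real (complexity X L1)"
        using C1 K0 LL mult_mono[of 2 C1 "real (complexity X L)" "real (complexity X L1)"] by simp
      then have "real (2 * complexity X L) * ln (real n) \<le> C1 * real (complexity X L1) * ln (real n)"
        using ln1 by (intro mult_right_mono) auto
      then show "exp (- C1 * real (complexity X L1) * ln (real n)) \<le> exp (- (real (2 * complexity X L) * ln (real n)))"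
        by simp
    qed auto
    ultimately show ?thesis unfolding L1_def s_def by linarith
  qed
  then show ?thesis using C1(2) unfolding p_def by blast
qed

end

section \<open>From return probabilities to the Foelner function\<close>

text \<open>The window length \<open>L\<close> is at most a multiple of \<open>n powr ((1 + \<delta>)/2)\<close>, because
  \<open>ln n \<le> n powr \<delta> / \<delta>\<close>; the exponents add up to \<open>(1 + \<delta>)/2 * \<alpha> + \<delta>\<close>, and \<open>\<delta>\<close> is chosen to make
  this \<open>\<gamma>\<close>.\<close>

lemma return_probability_stretched:
  fixes p :: "nat \<Rightarrow> real" and \<rho> :: "nat \<Rightarrow> nat"
  assumes C1: "C1 > 0" and mono: "\<And>m n. m \<le> n \<Longrightarrow> \<rho> m \<le> \<rho> n"
    and lower: "\<And>n. n \<ge> 1 \<Longrightarrow> p n \<ge> 1 / C1 *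
      exp (- C1 * real (\<rho> (nat \<lceil>C1 * sqrt (real n * ln (real n))\<rceil>)) * ln (real n))"
    and growth: "\<And>n. n \<ge> 1 \<Longrightarrow> real (\<rho> n) \<le> C * real n powr \<alpha>"
    and C: "C > 0" and \<alpha>: "\<alpha> \<ge> 0" and \<gamma>: "\<gamma> > \<alpha> / 2"
  shows "\<exists>D>0. \<forall>n\<ge>1. p n \<ge> exp (- D * real n powr \<gamma>)"
proof -
  define \<delta> where "\<delta> = (\<gamma> - \<alpha> / 2) / (1 + \<alpha> / 2)"
  have \<delta>: "\<delta> > 0" using \<gamma> \<alpha> by (simp add: \<delta>_def)
  have \<gamma>_eq: "(1 + \<delta>) / 2 * \<alpha> + \<delta> = \<gamma>"
  proof -
    have "\<delta> * (1 + \<alpha> / 2) = \<gamma> - \<alpha> / 2" using \<alpha> by (simp add: \<delta>_def)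
    then show ?thesis by (simp add: field_simps)
  qed
  define E where "E = C1 / sqrt \<delta> + 1"
  have E: "E \<ge> 1" using C1 \<delta> by (simp add: E_def)
  define D where "D = \<bar>ln C1\<bar> + C1 * (C * E powr \<alpha>) / \<delta>"
  have D: "D > 0" using C1 C E \<delta> by (simp add: D_def add_nonneg_pos)
  have "p n \<ge> exp (- D * real n powr \<gamma>)" if n: "n \<ge> 1" for n
  proof -
    define s where "s = sqrt (real n * ln (real n))"
    define L where "L = nat \<lceil>C1 * s\<rceil>"
    have n1: "1 \<le> real n" using n by simp
    have ln0: "0 \<le> ln (real n)" using n1 by simp
    have ln_le: "ln (real n) \<le> real n powr \<delta> / \<delta>" by (rule ln_powr_bound[OF n1 \<delta>])
    have "real n * ln (real n) \<le> real n * (real n powr \<delta> / \<delta>)"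
      using ln_le n1 by (intro mult_left_mono) auto
    also have "\<dots> = real n powr (1 + \<delta>) / \<delta>" using n1 by (simp add: powr_add)
    finally have "s \<le> sqrt (real n powr (1 + \<delta>) / \<delta>)" unfolding s_def by (rule real_sqrt_le_mono)
    also have "\<dots> = real n powr ((1 + \<delta>) / 2) / sqrt \<delta>"
      using n1 by (simp add: real_sqrt_divide powr_half_sqrt[symmetric] powr_powr)
    finally have "C1 * s \<le> C1 * (real n powr ((1 + \<delta>) / 2) / sqrt \<delta>)"
      using C1 by (intro mult_left_mono) auto
    moreover have np: "1 \<le> real n powr ((1 + \<delta>) / 2)"
      using n1 \<delta> by (intro ge_one_powr_ge_zero) auto
    moreover have s0: "0 \<le> s" unfolding s_def using n1 by simp
    moreover have "real L \<le> C1 * s + 1"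
      unfolding L_def using s0 C1 by (simp add: of_nat_ceiling le_of_int_ceiling)
    ultimately have "real L \<le> E * real n powr ((1 + \<delta>) / 2)"
      unfolding E_def by (simp add: algebra_simps)
    moreover have "1 \<le> E * real n powr ((1 + \<delta>) / 2)"
      using mult_mono[of 1 E 1 "real n powr ((1 + \<delta>) / 2)"] E np by simp
    ultimately have L: "real (max 1 L) \<le> E * real n powr ((1 + \<delta>) / 2)" by simp
    have "real (\<rho> L) \<le> real (\<rho> (max 1 L))" using mono[of L "max 1 L"] by simp
    also have "\<dots> \<le> C * real (max 1 L) powr \<alpha>" by (rule growth) simp
    also have "\<dots> \<le> C * (E * real n powr ((1 + \<delta>) / 2)) powr \<alpha>"
      using C L \<alpha> by (intro mult_left_mono powr_mono2) auto
    also have "\<dots> = C * E powr \<alpha> * real n powr ((1 + \<delta>) / 2 * \<alpha>)"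
      using E n1 by (simp add: powr_mult powr_powr)
    finally have "real (\<rho> L) * ln (real n)
        \<le> (C * E powr \<alpha> * real n powr ((1 + \<delta>) / 2 * \<alpha>)) * (real n powr \<delta> / \<delta>)"
      using ln_le ln0 by (intro mult_mono) (auto intro: order_trans[rotated])
    also have "\<dots> = C * E powr \<alpha> / \<delta> * real n powr \<gamma>"
      unfolding \<gamma>_eq[symmetric] powr_add by simp
    finally have "C1 * (real (\<rho> L) * ln (real n)) \<le> C1 * (C * E powr \<alpha> / \<delta> * real n powr \<gamma>)"
      using C1 by (intro mult_left_mono) auto
    moreover have "ln C1 \<le> \<bar>ln C1\<bar> * real n powr \<gamma>"
    proof -
      have "1 \<le> real n powr \<gamma>" using n1 \<gamma> \<alpha> by (intro ge_one_powr_ge_zero) auto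
      then show ?thesis using mult_left_mono[of 1 "real n powr \<gamma>" "\<bar>ln C1\<bar>"] by simp
    qed
    ultimately have "- D * real n powr \<gamma> \<le> - ln C1 + (- C1 * real (\<rho> L) * ln (real n))"
      by (simp add: D_def algebra_simps)
    then have "exp (- D * real n powr \<gamma>) \<le> exp (- ln C1) * exp (- C1 * real (\<rho> L) * ln (real n))"
      by (simp flip: exp_add)
    also have "exp (- ln C1) = 1 / C1" using C1 by (simp add: exp_minus field_simps)
    also have "1 / C1 * exp (- C1 * real (\<rho> L) * ln (real n)) \<le> p n"
      unfolding L_def s_def by (rule lower[OF n])
    finally show ?thesis .
  qed
  then show ?thesis using D by blast
qed

text \<open>Otherwise \<open>a\<close> would decay geometrically with a ratio below \<open>1 - l \<le> exp (- l)\<close>.\<close>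

lemma slow_step_exists:
  fixes a :: "nat \<Rightarrow> real"
  assumes "a 0 \<le> 1" "\<And>m. a m > 0" "0 < l" "l < 1" "M \<ge> 1" "a M \<ge> exp (- l * real M)"
  shows "\<exists>m<M. a m - a (Suc m) \<le> l * a m"
proof (rule ccontr)
  assume "\<not> ?thesis"
  then have step: "a (Suc m) < (1 - l) * a m" if "m < M" for m
    using that by (force simp: algebra_simps)
  have "a m \<le> (1 - l) ^ m" if "m \<le> M" for m
    using that
  proof (induction m)
    case 0 then show ?case using assms(1) by simp
  next
    case (Suc m)
    have "a (Suc m) \<le> (1 - l) * a m" using step[of m] Suc.prems by simp
    also have "\<dots> \<le> (1 - l) * (1 - l) ^ m" using Suc assms(4) by (intro mult_left_mono) auto
    finally show ?case by simp
  qed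
  note power = this
  obtain m where m: "M = Suc m" using assms(5) by (cases M) auto
  have "a M < (1 - l) * a m" using step[of m] m by simp
  also have "\<dots> \<le> (1 - l) * (1 - l) ^ m" using power[of m] m assms(4) by (intro mult_left_mono) auto
  also have "\<dots> = (1 - l) ^ M" by (simp add: m)
  also have "(1 - l) ^ M \<le> exp (- l) ^ M"
    using exp_ge_add_one_self[of "- l"] assms(4) by (intro power_mono) auto
  also have "\<dots> = exp (- l * real M)" by (simp add: exp_of_nat_mult[symmetric] mult.commute)
  finally show False using assms(6) by simp
qed

text \<open>By \<open>slow_step_exists\<close>, some step below \<open>M\<close> loses at most the fraction \<open>l\<close>, provided that
  \<open>D M powr \<gamma> \<le> l M\<close>. Since \<open>l\<close> is of order \<open>1/n\<^sup>2\<close>, this holds once \<open>M powr (1 - \<gamma>)\<close> is a large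
  multiple of \<open>n\<^sup>2\<close>. The resulting Foelner set has at most \<open>4 exp (D M powr \<gamma>)\<close> elements.\<close>

theorem (in group) foelner_function_bound:
  fixes S :: "'a set"
  defines "\<mu> \<equiv> pmf_of_set (insert \<one> S)"
  assumes S: "finite S" "S \<subseteq> carrier G" "\<forall>s\<in>S. inv s \<in> S"
    and decay: "\<And>n. n \<ge> 1 \<Longrightarrow> exp (- D * real n powr \<gamma>) \<le> pmf (convolution_power G \<mu> (2 * n)) \<one>"
    and D: "D > 0" and \<gamma>: "0 < \<gamma>" "\<gamma> < 1"
  shows "\<exists>C2>0. \<forall>n\<ge>1. ereal_of_enat (foelner_function G S n)
    \<le> ereal (C2 * exp (C2 * real n powr (2 * \<gamma> / (1 - \<gamma>))))"
proof -
  define N where "N = real (card (insert \<one> S))"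
  have N1: "N \<ge> 1" using S by (simp add: N_def Suc_le_eq card_gt_0_iff)
  define a where "a m = pmf (convolution_power G \<mu> (2 * m)) \<one>" for m
  have sm: "set_pmf \<mu> \<subseteq> carrier G" "finite (set_pmf \<mu>)" using S by (auto simp: \<mu>_def)
  have sym: "symmetric_pmf G \<mu>" unfolding \<mu>_def by (rule symmetric_pmf_of_generators[OF S])
  have a_pos: "a m > 0" for m unfolding a_def by (rule return_probability_pos[OF sm sym])
  have a_anti: "a (Suc m) \<le> a m" for m
  proof -
    have "0 \<le> 2 * N * (1 + N) * (a m - a (Suc m))"
      unfolding a_def N_def \<mu>_def
      by (rule order_trans[OF _ dirichlet_form_le(1)[OF S]]) (intro sum_nonneg zero_le_power2)
    moreover have "0 < 2 * N * (1 + N)" using N1 by simp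
    ultimately show ?thesis by (simp only: zero_le_mult_iff) linarith
  qed
  define Q where "Q = 32 * N\<^sup>2 * (1 + N)"
  have Q: "Q > 1"
  proof -
    have "1 \<le> N\<^sup>2 * (1 + N)" using mult_mono[of 1 "N\<^sup>2" 1 "1 + N"] N1 by simp
    then show ?thesis by (simp add: Q_def)
  qed
  define Z where "Z = max 1 (D * Q)"
  define e where "e = 1 / (1 - \<gamma>)"
  have e: "e > 0" using \<gamma> by (simp add: e_def)
  define C2 where "C2 = max 4 (D * (2 powr \<gamma> * Z powr (e * \<gamma>)))"
  have "ereal_of_enat (foelner_function G S n) \<le> ereal (C2 * exp (C2 * real n powr (2 * \<gamma> / (1 - \<gamma>))))"
    if n: "n \<ge> 1" for n
  proof -
    have n1: "real n \<ge> 1" using n by simp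
    define y where "y = (Z * (real n)\<^sup>2) powr e"
    define M where "M = nat \<lceil>y\<rceil>"
    have Zn: "1 \<le> Z * (real n)\<^sup>2"
      using mult_mono[of 1 Z 1 "(real n)\<^sup>2"] n1 by (simp add: Z_def)
    have y1: "1 \<le> y" unfolding y_def using Zn e by (intro ge_one_powr_ge_zero) auto
    have yM: "y \<le> real M" unfolding M_def by (rule real_nat_ceiling_ge)
    have M1: "M \<ge> 1" using y1 yM by linarith
    have My: "real M \<le> 2 * y"
      unfolding M_def using y1 by linarith
    have "Z * (real n)\<^sup>2 = y powr (1 - \<gamma>)"
      unfolding y_def using Zn \<gamma> by (simp add: powr_powr e_def)
    also have "\<dots> \<le> real M powr (1 - \<gamma>)" using yM y1 \<gamma> by (intro powr_mono2) auto
    finally have "Z * (real n)\<^sup>2 * real M powr \<gamma> \<le> real M powr (1 - \<gamma>) * real M powr \<gamma>"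
      by (intro mult_right_mono) auto
    also have "\<dots> = real M" using M1 by (simp flip: powr_add)
    finally have ZM: "Z * (real n)\<^sup>2 * real M powr \<gamma> \<le> real M" .
    define l where "l = 1 / (Q * (real n)\<^sup>2)"
    have Qn: "Q * (real n)\<^sup>2 > 1" using mult_mono[of 1 Q 1 "(real n)\<^sup>2"] Q n1
      by (intro less_le_trans[OF Q]) simp
    have l: "0 < l" "l < 1" using Qn unfolding l_def by auto
    have "D * Q * ((real n)\<^sup>2 * real M powr \<gamma>) \<le> Z * ((real n)\<^sup>2 * real M powr \<gamma>)"
      by (intro mult_right_mono) (auto simp: Z_def)
    then have "D * real M powr \<gamma> \<le> l * real M"
      using ZM Q n1 unfolding l_def by (simp add: field_simps)
    then have "exp (- l * real M) \<le> exp (- D * real M powr \<gamma>)" by simp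
    also have aM: "\<dots> \<le> a M" unfolding a_def by (rule decay[OF M1])
    finally obtain m where m: "m < M" "a m - a (Suc m) \<le> l * a m"
      using slow_step_exists[of a l M] a_pos l M1 by (auto simp: a_def pmf_le_1)
    have "a m - a (Suc m) \<le> a m / (32 * N\<^sup>2 * (1 + N) * (real n)\<^sup>2)"
      using m(2) by (simp add: l_def Q_def)
    then obtain F where F: "F \<subseteq> carrier G" "finite F" "F \<noteq> {}"
      "real (card (inner_boundary G S F)) \<le> 1 / real n * real (card F)" "real (card F) \<le> 4 / a m"
      using foelner_set_of_slow_decay[OF S n, of m] unfolding a_def N_def \<mu>_def by auto
    have "a M \<le> a m" using lift_Suc_antimono_le[of a m M, OF a_anti] m(1) by simp
    then have "4 / a m \<le> 4 / a M" using a_pos by (intro divide_left_mono) auto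
    also have "\<dots> \<le> 4 / exp (- D * real M powr \<gamma>)" using aM a_pos by (intro divide_left_mono) auto
    also have "\<dots> = 4 * exp (D * real M powr \<gamma>)" by (simp add: exp_minus field_simps)
    also have "\<dots> \<le> C2 * exp (C2 * real n powr (2 * \<gamma> / (1 - \<gamma>)))"
    proof (intro mult_mono)
      have "real M powr \<gamma> \<le> (2 * y) powr \<gamma>" using My \<gamma> by (intro powr_mono2) auto
      also have "\<dots> = 2 powr \<gamma> * y powr \<gamma>" using y1 by (simp add: powr_mult)
      also have "y powr \<gamma> = (Z * (real n)\<^sup>2) powr (e * \<gamma>)" by (simp add: y_def powr_powr)
      also have "\<dots> = Z powr (e * \<gamma>) * ((real n)\<^sup>2) powr (e * \<gamma>)"
        by (rule powr_mult)
      also have "((real n)\<^sup>2) powr (e * \<gamma>) = real n powr (2 * \<gamma> / (1 - \<gamma>))"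
        using n1 by (simp add: powr_powr e_def flip: powr_numeral)
      finally have "D * real M powr \<gamma> \<le> D * (2 powr \<gamma> * (Z powr (e * \<gamma>) * real n powr (2 * \<gamma> / (1 - \<gamma>))))"
        using D by (intro mult_left_mono) auto
      also have "\<dots> = D * (2 powr \<gamma> * Z powr (e * \<gamma>)) * real n powr (2 * \<gamma> / (1 - \<gamma>))"
        by (simp only: mult.assoc)
      also have "\<dots> \<le> C2 * real n powr (2 * \<gamma> / (1 - \<gamma>))"
        by (intro mult_right_mono) (auto simp: C2_def)
      finally show "exp (D * real M powr \<gamma>) \<le> exp (C2 * real n powr (2 * \<gamma> / (1 - \<gamma>)))" by simp
    qed (auto simp: C2_def)
    finally have card: "real (card F) \<le> C2 * exp (C2 * real n powr (2 * \<gamma> / (1 - \<gamma>)))" using F(5) by linarith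
    have "foelner_function G S n \<le> enat (card F)"
      unfolding foelner_function_def using F by (intro INF_lower) auto
    then have "ereal_of_enat (foelner_function G S n) \<le> ereal_of_enat (enat (card F))"
      by (simp only: ereal_of_enat_le_iff)
    also have "\<dots> = ereal (real (card F))" by simp
    also have "\<dots> \<le> ereal (C2 * exp (C2 * real n powr (2 * \<gamma> / (1 - \<gamma>))))" using card by simp
    finally show ?thesis .
  qed
  moreover have "C2 > 0" by (simp add: C2_def)
  ultimately show ?thesis by blast
qed

lemma convolution_power_carrier_update:
  "convolution_power (G\<lparr>carrier := H\<rparr>) \<mu> n = convolution_power G \<mu> n"
  by (induction n) (simp_all add: convolution_def)

section \<open>Return probabilities and Foelner functions of subshifts of low complexity\<close>

theorem corollary1p7:
  fixes A :: "'a set" and X :: "(int \<Rightarrow> 'a) set"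
  assumes "subshift A X"
    and "no_isolated_periodic_points A X"
    and "(\<lambda>n. (ln (real n) / real n)\<^sup>2 * real (complexity X n)) \<longlonglongrightarrow> 0"
  shows "(\<forall>\<mu>. set_pmf \<mu> \<subseteq> carrier (topological_full_group A X) \<longrightarrow> finite (set_pmf \<mu>) \<longrightarrow>
            symmetric_pmf (topological_full_group A X) \<mu> \<longrightarrow>
            (\<exists>C1 > 0. \<forall>n \<ge> 1.
               pmf (convolution_power (topological_full_group A X) \<mu> (2 * n))
                   \<one>\<^bsub>topological_full_group A X\<^esub>
               \<ge> 1 / C1 * exp (- C1 *
                    real (complexity X (nat \<lceil>C1 * sqrt (real n * ln (real n))\<rceil>)) * ln (real n))))
       \<and> (\<forall>C \<alpha>. C > 0 \<longrightarrow> 1 \<le> \<alpha> \<longrightarrow> \<alpha> < 2 \<longrightarrow>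
            (\<forall>n \<ge> 1. real (complexity X n) \<le> C * real n powr \<alpha>) \<longrightarrow>
            (\<forall>H S \<epsilon>. subgroup H (topological_full_group A X) \<longrightarrow>
               finite S \<longrightarrow>
               symmetric_generating_set ((topological_full_group A X)\<lparr>carrier := H\<rparr>) S \<longrightarrow>
               \<epsilon> > 0 \<longrightarrow>
               (\<exists>C2 > 0. \<forall>n \<ge> 1.
                  ereal_of_enat (foelner_function ((topological_full_group A X)\<lparr>carrier := H\<rparr>) S n)
                  \<le> ereal (C2 * exp (C2 * real n powr (2 * \<alpha> / (2 - \<alpha>) + \<epsilon>))))))"
proof (intro conjI allI impI)
  interpret nonisolated_subshift A X
    using assms(1,2) by unfold_locales
  have part1: "\<exists>C1>0. \<forall>n\<ge>1. pmf (convolution_power \<G> \<mu> (2 * n)) \<one>\<^bsub>\<G>\<^esub>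
      \<ge> 1 / C1 * exp (- C1 * real (complexity X (nat \<lceil>C1 * sqrt (real n * ln (real n))\<rceil>)) * ln (real n))"
    if "set_pmf \<mu> \<subseteq> carrier \<G>" "finite (set_pmf \<mu>)" "symmetric_pmf \<G> \<mu>" for \<mu>
  proof -
    from that obtain K where "full_group_walk A X \<mu> K" using walk_exists by blast
    then interpret full_group_walk A X \<mu> K .
    show ?thesis by (rule return_probability_lower_bound[OF assms(3)])
  qed
  show "\<exists>C1>0. \<forall>n\<ge>1. pmf (convolution_power \<G> \<mu> (2 * n)) \<one>\<^bsub>\<G>\<^esub>
      \<ge> 1 / C1 * exp (- C1 * real (complexity X (nat \<lceil>C1 * sqrt (real n * ln (real n))\<rceil>)) * ln (real n))"
    if "set_pmf \<mu> \<subseteq> carrier \<G>" "finite (set_pmf \<mu>)" "symmetric_pmf \<G> \<mu>" for \<mu>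
    using that by (rule part1)
  fix C \<alpha> \<epsilon> :: real and H S
  assume C: "C > 0" and \<alpha>: "1 \<le> \<alpha>" "\<alpha> < 2"
    and growth: "\<forall>n\<ge>1. real (complexity X n) \<le> C * real n powr \<alpha>"
    and H: "subgroup H \<G>" and S: "finite S"
    and gen: "symmetric_generating_set (\<G>\<lparr>carrier := H\<rparr>) S" and \<epsilon>: "\<epsilon> > 0"
  let ?H = "\<G>\<lparr>carrier := H\<rparr>"
  interpret H: group ?H using H by (rule full_group.subgroup_imp_group)
  have S': "S \<subseteq> carrier ?H" "\<forall>s\<in>S. inv\<^bsub>?H\<^esub> s \<in> S"
    using gen by (auto simp: symmetric_generating_set_def)
  define \<mu> where "\<mu> = pmf_of_set (insert \<one>\<^bsub>?H\<^esub> S)"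
  have H_sub: "H \<subseteq> carrier \<G>" using H by (rule subgroup.subset)
  have supp: "set_pmf \<mu> = insert \<one>\<^bsub>\<G>\<^esub> S" using S by (simp add: \<mu>_def)
  have sub: "set_pmf \<mu> \<subseteq> H" using S'(1) subgroup.one_closed[OF H] by (simp add: supp)
  have "symmetric_pmf ?H \<mu>" unfolding \<mu>_def by (rule H.symmetric_pmf_of_generators[OF S S'])
  have "symmetric_pmf \<G> \<mu>"
    unfolding symmetric_pmf_def
  proof
    fix g assume g: "g \<in> carrier \<G>"
    show "pmf \<mu> g = pmf \<mu> (inv\<^bsub>\<G>\<^esub> g)"
    proof (cases "g \<in> H")
      case True
      then have "inv\<^bsub>?H\<^esub> g = inv\<^bsub>\<G>\<^esub> g" by (rule full_group.m_inv_consistent[OF H])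
      then show ?thesis using \<open>symmetric_pmf ?H \<mu>\<close> True unfolding symmetric_pmf_def by fastforce
    next
      case False
      then have "inv\<^bsub>\<G>\<^esub> g \<notin> H" using subgroup.m_inv_closed[OF H] g by fastforce
      then show ?thesis using False sub by (metis set_pmf_iff subsetD)
    qed
  qed
  then obtain C1 where C1: "C1 > 0" "\<And>n. n \<ge> 1 \<Longrightarrow> pmf (convolution_power \<G> \<mu> (2 * n)) \<one>\<^bsub>\<G>\<^esub>
      \<ge> 1 / C1 * exp (- C1 * real (complexity X (nat \<lceil>C1 * sqrt (real n * ln (real n))\<rceil>)) * ln (real n))"
    using part1[of \<mu>] sub H_sub S supp by auto
  \<comment> \<open>The exponent \<open>\<gamma>\<close> is the solution of \<open>2\<gamma>/(1 - \<gamma>) = b\<close>. For \<open>\<epsilon> = 0\<close> it would equal \<open>\<alpha>/2\<close>, hence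
    it lies strictly above \<open>\<alpha>/2\<close>.\<close>
  define b where "b = 2 * \<alpha> / (2 - \<alpha>) + \<epsilon>"
  define \<gamma> where "\<gamma> = b / (2 + b)"
  have b: "b > 0" using \<alpha> \<epsilon> by (simp add: b_def add_nonneg_pos)
  have \<gamma>: "0 < \<gamma>" "\<gamma> < 1" "2 * \<gamma> / (1 - \<gamma>) = b"
    using b by (simp_all add: \<gamma>_def field_simps)
  have "b * (2 - \<alpha>) = 2 * \<alpha> + \<epsilon> * (2 - \<alpha>)" using \<alpha> by (simp add: b_def field_simps)
  then have "b * (2 - \<alpha>) > 2 * \<alpha>" using \<alpha> \<epsilon> by simp
  then have \<gamma>\<alpha>: "\<gamma> > \<alpha> / 2" using b by (simp add: \<gamma>_def field_simps)
  obtain D where D: "D > 0"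
    "\<And>n. n \<ge> 1 \<Longrightarrow> exp (- D * real n powr \<gamma>) \<le> pmf (convolution_power \<G> \<mu> (2 * n)) \<one>\<^bsub>\<G>\<^esub>"
    using return_probability_stretched[where \<rho> = "complexity X" and C = C and \<alpha> = \<alpha> and \<gamma> = \<gamma>,
        OF C1(1) complexity_mono C1(2) _ C _ \<gamma>\<alpha>] growth \<alpha> by auto
  have "\<exists>C2>0. \<forall>n\<ge>1. ereal_of_enat (foelner_function ?H S n)
      \<le> ereal (C2 * exp (C2 * real n powr (2 * \<gamma> / (1 - \<gamma>))))"
  proof (rule H.foelner_function_bound[OF S S' _ D(1) \<gamma>(1,2)])
    fix n :: nat assume "n \<ge> 1"
    then show "exp (- D * real n powr \<gamma>)
        \<le> pmf (convolution_power ?H (pmf_of_set (insert \<one>\<^bsub>?H\<^esub> S)) (2 * n)) \<one>\<^bsub>?H\<^esub>"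
      using D(2) unfolding \<mu>_def[symmetric] by (simp add: convolution_power_carrier_update)
  qed
  then show "\<exists>C2>0. \<forall>n\<ge>1. ereal_of_enat (foelner_function ?H S n)
      \<le> ereal (C2 * exp (C2 * real n powr (2 * \<alpha> / (2 - \<alpha>) + \<epsilon>)))"
    unfolding \<gamma>(3) b_def .
qed

end
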